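(* Let $\lambda>0$ be a constant and let $$G=\left\{\begin{pmatrix}y&x\\0&1\end{pmatrix} : x,y\in\mathbb{R},\ y>0\right\}$$ be the $2$-dimensional solvable Lie group with the left-invariant metric $g=(dx^2+\lambda^2\,dy^2)/y^2$. Suppose $G$ admits a left-invariant statistical structure $(g,\nabla)$ satisfying one of the following conditions (which are mutually equivalent): (1) $\nabla^gC$ is totally symmetric; (2) $\nabla C$ is totally symmetric; (3) $\nabla^gK$ is totally symmetric; (4) $R=R^*$. Then $\nabla$ is given by $$\nabla_{e_1}e_1=\left(\frac1\lambda-\frac p2\right)e_2,\quad \nabla_{e_1}e_2=\left(-\frac1\lambda-\frac p2\right)e_1,\quad \nabla_{e_2}e_1=-\frac p2e_1,\quad \nabla_{e_2}e_2=-p\,e_2$$ for some $p\in\mathbb{R}$, where $\{e_1,e_2\}$ is the left-invariant orthonormal frame field described in the context.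
   Context: The Lie algebra of $G$ is spanned by $E_1=\begin{pmatrix}0&1\\0&0\end{pmatrix}$ and $E_2=\begin{pmatrix}1&0\\0&0\end{pmatrix}$. Put $e_1=E_1$ and $e_2=\lambda^{-1}E_2$, regarded as left-invariant vector fields on $G$; in the global coordinates $(x,y)$, $e_1=y\,\partial_x$ and $e_2=\lambda^{-1}y\,\partial_y$. They are orthonormal for $g$ and $[e_1,e_2]=-\lambda^{-1}e_1$. A statistical structure $(g,\nabla)$ on a manifold consists of a Riemannian metric $g$ and a torsion-free affine connection $\nabla$ such that $\nabla g$ is totally symmetric; on a Lie group it is left-invariant if both $g$ and $\nabla$ are invariant under left translations. $\nabla^g$ denotes the Levi-Civita connection of $g$. The cubic form is $C(X,Y,Z)=(\nabla_Xg)(Y,Z)$; the skewness operator $K$ is defined by $g(K(X,Y),Z)=C(X,Y,Z)$, so that $\nabla=\nabla^g-\frac12K$; the dual connection $\nabla^*$ is defined by $Xg(Y,Z)=g(\nabla_XY,Z)+g(Y,\nabla^*_XZ)$; $R$ and $R^*$ are the curvature tensor fields of $\nabla$ and $\nabla^*$. "$\nabla^gC$ (resp. $\nabla C$) is totally symmetric" means that $(\nabla^g_XC)(Y,Z,W)$ (resp. $(\nabla_XC)(Y,Z,W)$) is symmetric in $X,Y,Z,W$; "$\nabla^gK$ is totally symmetric" means that $(\nabla^g_XK)(Y,Z)$ is symmetric in $X,Y,Z$. *)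

theory Defs
  imports "HOL-Analysis.Analysis"
begin

section \<open>Statistical structures on an open subset of a Euclidean space\<close>

text \<open>
  All objects live on an open set \<open>U\<close> (a manifold with one global chart). Functions and vector
  fields on \<open>U\<close> are total functions of which only the values on \<open>U\<close> matter.
\<close>

primrec Ck_on ::
  "nat \<Rightarrow> 'a::euclidean_space set \<Rightarrow> ('a \<Rightarrow> 'b::real_normed_vector) \<Rightarrow> bool" where
  "Ck_on 0 U f \<longleftrightarrow> continuous_on U f"
| "Ck_on (Suc k) U f \<longleftrightarrow>
     (\<forall>p\<in>U. f differentiable (at p)) \<and>
     (\<forall>v. Ck_on k U (\<lambda>p. frechet_derivative f (at p) v))"

definition smooth_on ::
  "'a::euclidean_space set \<Rightarrow> ('a \<Rightarrow> 'b::real_normed_vector) \<Rightarrow> bool" where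
  "smooth_on U f \<longleftrightarrow> (\<forall>k. Ck_on k U f)"

type_synonym 'a vfield = "'a \<Rightarrow> 'a"
type_synonym 'a metric = "'a \<Rightarrow> 'a \<Rightarrow> 'a \<Rightarrow> real"
type_synonym 'a vf_operator = "'a vfield \<Rightarrow> 'a vfield \<Rightarrow> 'a vfield"
type_synonym 'a vf_form3 = "'a vfield \<Rightarrow> 'a vfield \<Rightarrow> 'a vfield \<Rightarrow> 'a \<Rightarrow> real"

definition vector_fields :: "'a::euclidean_space set \<Rightarrow> 'a vfield set" where
  "vector_fields U = {X. smooth_on U X}"

definition vf_apply :: "'a::euclidean_space vfield \<Rightarrow> ('a \<Rightarrow> real) \<Rightarrow> 'a \<Rightarrow> real" where
  "vf_apply X f p = frechet_derivative f (at p) (X p)"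

definition lie_bracket :: "'a::euclidean_space vf_operator" where
  "lie_bracket X Y p = frechet_derivative Y (at p) (X p) - frechet_derivative X (at p) (Y p)"

definition riemannian_metric :: "'a::euclidean_space set \<Rightarrow> 'a metric \<Rightarrow> bool" where
  "riemannian_metric U g \<longleftrightarrow>
     (\<forall>p\<in>U. bilinear (g p) \<and> (\<forall>v w. g p v w = g p w v) \<and> (\<forall>v. v \<noteq> 0 \<longrightarrow> g p v v > 0)) \<and>
     (\<forall>v w. smooth_on U (\<lambda>p. g p v w))"

text \<open>
  The second conjunct makes the operator well defined on vector fields on \<open>U\<close>. Linearity over
  the reals in the second argument is the Leibniz rule for constant functions.
\<close>

definition affine_connection :: "'a::euclidean_space set \<Rightarrow> 'a vf_operator \<Rightarrow> bool" where
  "affine_connection U D \<longleftrightarrow>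
     (\<forall>X\<in>vector_fields U. \<forall>Y\<in>vector_fields U. D X Y \<in> vector_fields U) \<and>
     (\<forall>X\<in>vector_fields U. \<forall>X'\<in>vector_fields U. \<forall>Y\<in>vector_fields U. \<forall>Y'\<in>vector_fields U.
        (\<forall>p\<in>U. X p = X' p \<and> Y p = Y' p) \<longrightarrow> (\<forall>p\<in>U. D X Y p = D X' Y' p)) \<and>
     (\<forall>X\<in>vector_fields U. \<forall>X'\<in>vector_fields U. \<forall>Y\<in>vector_fields U. \<forall>p\<in>U.
        D (\<lambda>q. X q + X' q) Y p = D X Y p + D X' Y p) \<and>
     (\<forall>X\<in>vector_fields U. \<forall>Y\<in>vector_fields U. \<forall>Y'\<in>vector_fields U. \<forall>p\<in>U.
        D X (\<lambda>q. Y q + Y' q) p = D X Y p + D X Y' p) \<and>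
     (\<forall>f::'a \<Rightarrow> real. smooth_on U f \<longrightarrow>
        (\<forall>X\<in>vector_fields U. \<forall>Y\<in>vector_fields U. \<forall>p\<in>U.
           D (\<lambda>q. f q *\<^sub>R X q) Y p = f p *\<^sub>R D X Y p \<and>
           D X (\<lambda>q. f q *\<^sub>R Y q) p = f p *\<^sub>R D X Y p + vf_apply X f p *\<^sub>R Y p))"

definition torsion_free :: "'a::euclidean_space set \<Rightarrow> 'a vf_operator \<Rightarrow> bool" where
  "torsion_free U D \<longleftrightarrow>
     (\<forall>X\<in>vector_fields U. \<forall>Y\<in>vector_fields U. \<forall>p\<in>U.
        D X Y p - D Y X p = lie_bracket X Y p)"

definition cubic_form :: "'a::euclidean_space metric \<Rightarrow> 'a vf_operator \<Rightarrow> 'a vf_form3" where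
  "cubic_form g D X Y Z p =
     vf_apply X (\<lambda>q. g q (Y q) (Z q)) p - g p (D X Y p) (Z p) - g p (Y p) (D X Z p)"

definition statistical_structure ::
  "'a::euclidean_space set \<Rightarrow> 'a metric \<Rightarrow> 'a vf_operator \<Rightarrow> bool" where
  "statistical_structure U g D \<longleftrightarrow>
     riemannian_metric U g \<and> affine_connection U D \<and> torsion_free U D \<and>
     (\<forall>X\<in>vector_fields U. \<forall>Y\<in>vector_fields U. \<forall>Z\<in>vector_fields U. \<forall>p\<in>U.
        cubic_form g D X Y Z p = cubic_form g D Y X Z p \<and>
        cubic_form g D X Y Z p = cubic_form g D X Z Y p)"

text \<open>
  The three operators below are uniquely determined by their defining property as far as their
  values on \<open>U\<close> at smooth arguments are concerned; the choice only fixes irrelevant values.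
\<close>

definition levi_civita :: "'a::euclidean_space set \<Rightarrow> 'a metric \<Rightarrow> 'a vf_operator" where
  "levi_civita U g = (SOME D. affine_connection U D \<and> torsion_free U D \<and>
     (\<forall>X\<in>vector_fields U. \<forall>Y\<in>vector_fields U. \<forall>Z\<in>vector_fields U. \<forall>p\<in>U.
        vf_apply X (\<lambda>q. g q (Y q) (Z q)) p = g p (D X Y p) (Z p) + g p (Y p) (D X Z p)))"

definition skewness ::
  "'a::euclidean_space set \<Rightarrow> 'a metric \<Rightarrow> 'a vf_operator \<Rightarrow> 'a vf_operator" where
  "skewness U g D = (SOME K. \<forall>X\<in>vector_fields U. \<forall>Y\<in>vector_fields U.
     K X Y \<in> vector_fields U \<and>
     (\<forall>Z\<in>vector_fields U. \<forall>p\<in>U. g p (K X Y p) (Z p) = cubic_form g D X Y Z p))"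

definition dual_connection ::
  "'a::euclidean_space set \<Rightarrow> 'a metric \<Rightarrow> 'a vf_operator \<Rightarrow> 'a vf_operator" where
  "dual_connection U g D = (SOME D'. \<forall>X\<in>vector_fields U. \<forall>Z\<in>vector_fields U.
     D' X Z \<in> vector_fields U \<and>
     (\<forall>Y\<in>vector_fields U. \<forall>p\<in>U.
        vf_apply X (\<lambda>q. g q (Y q) (Z q)) p = g p (D X Y p) (Z p) + g p (Y p) (D' X Z p)))"

definition curvature ::
  "'a::euclidean_space vf_operator \<Rightarrow> 'a vfield \<Rightarrow> 'a vfield \<Rightarrow> 'a vfield \<Rightarrow> 'a vfield" where
  "curvature D X Y Z p = D X (D Y Z) p - D Y (D X Z) p - D (lie_bracket X Y) Z p"

definition cov_deriv_form3 ::
  "'a::euclidean_space vf_operator \<Rightarrow> 'a vf_form3 \<Rightarrow> 'a vfield \<Rightarrow> 'a vf_form3" where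
  "cov_deriv_form3 D C X Y Z W p =
     vf_apply X (C Y Z W) p - C (D X Y) Z W p - C Y (D X Z) W p - C Y Z (D X W) p"

definition cov_deriv_op ::
  "'a::euclidean_space vf_operator \<Rightarrow> 'a vf_operator \<Rightarrow> 'a vfield \<Rightarrow> 'a vf_operator" where
  "cov_deriv_op D K X Y Z p = D X (K Y Z) p - K (D X Y) Z p - K Y (D X Z) p"

text \<open>Total symmetry is imposed for adjacent transpositions, which generate all permutations.\<close>

definition totally_symmetric3 ::
  "'a::euclidean_space set \<Rightarrow> ('a vfield \<Rightarrow> 'a vfield \<Rightarrow> 'a vfield \<Rightarrow> 'a \<Rightarrow> 'b) \<Rightarrow> bool" where
  "totally_symmetric3 U T \<longleftrightarrow>
     (\<forall>X\<in>vector_fields U. \<forall>Y\<in>vector_fields U. \<forall>Z\<in>vector_fields U. \<forall>p\<in>U.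
        T X Y Z p = T Y X Z p \<and> T X Y Z p = T X Z Y p)"

definition totally_symmetric4 ::
  "'a::euclidean_space set \<Rightarrow> ('a vfield \<Rightarrow> 'a vfield \<Rightarrow> 'a vfield \<Rightarrow> 'a vfield \<Rightarrow> 'a \<Rightarrow> 'b) \<Rightarrow> bool"
where
  "totally_symmetric4 U T \<longleftrightarrow>
     (\<forall>X\<in>vector_fields U. \<forall>Y\<in>vector_fields U. \<forall>Z\<in>vector_fields U. \<forall>W\<in>vector_fields U. \<forall>p\<in>U.
        T X Y Z W p = T Y X Z W p \<and> T X Y Z W p = T X Z Y W p \<and> T X Y Z W p = T X Y W Z p)"

section \<open>The group of matrices with rows \<open>(y, x)\<close> and \<open>(0, 1)\<close>, \<open>y > 0\<close>\<close>

definition aff_mat :: "real \<times> real \<Rightarrow> real^2^2" where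
  "aff_mat p = vector [vector [snd p, fst p], vector [0, 1]]"

definition aff_group :: "(real^2^2) set" where
  "aff_group = {A. \<exists>x y. y > 0 \<and> A = vector [vector [y, x], vector [0, 1]]}"

text \<open>
  The global chart \<open>(x, y)\<close> reads off the first row. It is linear, so it also gives the
  coordinate components of a tangent vector presented as a matrix.
\<close>

definition mat_coords :: "real^2^2 \<Rightarrow> real \<times> real" where
  "mat_coords A = (A $ 1 $ 2, A $ 1 $ 1)"

definition half_plane :: "(real \<times> real) set" where
  "half_plane = {p. snd p > 0}"

definition left_translation :: "real \<times> real \<Rightarrow> real \<times> real \<Rightarrow> real \<times> real" where
  "left_translation a p = mat_coords (aff_mat a ** aff_mat p)"

definition group_inverse :: "real \<times> real \<Rightarrow> real \<times> real" where
  "group_inverse a = mat_coords (matrix_inv (aff_mat a))"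

definition left_pushforward :: "real \<times> real \<Rightarrow> (real \<times> real) vfield \<Rightarrow> (real \<times> real) vfield" where
  "left_pushforward a X p =
     (let q = left_translation (group_inverse a) p
      in frechet_derivative (left_translation a) (at q) (X q))"

definition left_invariant_metric :: "(real \<times> real) metric \<Rightarrow> bool" where
  "left_invariant_metric g \<longleftrightarrow>
     (\<forall>a\<in>half_plane. \<forall>p\<in>half_plane. \<forall>v w.
        g (left_translation a p) (frechet_derivative (left_translation a) (at p) v)
          (frechet_derivative (left_translation a) (at p) w) = g p v w)"

definition left_invariant_connection :: "(real \<times> real) vf_operator \<Rightarrow> bool" where
  "left_invariant_connection D \<longleftrightarrow>
     (\<forall>a\<in>half_plane. \<forall>X\<in>vector_fields half_plane. \<forall>Y\<in>vector_fields half_plane. \<forall>p\<in>half_plane.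
        D (left_pushforward a X) (left_pushforward a Y) p = left_pushforward a (D X Y) p)"

definition left_invariant_statistical_structure ::
  "(real \<times> real) metric \<Rightarrow> (real \<times> real) vf_operator \<Rightarrow> bool" where
  "left_invariant_statistical_structure g D \<longleftrightarrow>
     statistical_structure half_plane g D \<and>
     left_invariant_metric g \<and> left_invariant_connection D"

definition metric_G :: "real \<Rightarrow> (real \<times> real) metric" where
  "metric_G lam p v w = (fst v * fst w + lam\<^sup>2 * (snd v * snd w)) / (snd p)\<^sup>2"

text \<open>The left-invariant vector field generated by a matrix \<open>E\<close> is \<open>A \<mapsto> A ** E\<close>.\<close>

definition left_invariant_field :: "real^2^2 \<Rightarrow> (real \<times> real) vfield" where
  "left_invariant_field E p = mat_coords (aff_mat p ** E)"

definition e1 :: "(real \<times> real) vfield" where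
  "e1 = left_invariant_field (vector [vector [0, 1], vector [0, 0]])"

definition e2 :: "real \<Rightarrow> (real \<times> real) vfield" where
  "e2 lam p = (1 / lam) *\<^sub>R left_invariant_field (vector [vector [1, 0], vector [0, 0]]) p"

lemma aff_group_chart:
  "bij_betw mat_coords aff_group half_plane"
  "p \<in> half_plane \<Longrightarrow> aff_mat p \<in> aff_group"
  "mat_coords (aff_mat p) = p"
proof -
  show "bij_betw mat_coords aff_group half_plane"
    by (rule bij_betw_byWitness[where f' = aff_mat])
       (auto simp: aff_group_def half_plane_def mat_coords_def aff_mat_def vector_2)
  show "p \<in> half_plane \<Longrightarrow> aff_mat p \<in> aff_group"
    by (auto simp: aff_group_def half_plane_def aff_mat_def)
  show "mat_coords (aff_mat p) = p"
    by (simp add: mat_coords_def aff_mat_def)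
qed

lemma left_translation_eq:
  "left_translation a p = (snd a * fst p + fst a, snd a * snd p)"
  by (simp add: left_translation_def mat_coords_def aff_mat_def matrix_matrix_mult_def sum_2)

lemma aff_mat_mult: "aff_mat a ** aff_mat p = aff_mat (left_translation a p)"
  by (simp add: left_translation_eq aff_mat_def matrix_matrix_mult_def sum_2 vec_eq_iff forall_2)

lemma group_inverse_eq:
  assumes "a \<in> half_plane"
  shows "group_inverse a = (- fst a / snd a, 1 / snd a)"
proof -
  let ?b = "aff_mat (- fst a / snd a, 1 / snd a)"
  have ab: "aff_mat a ** ?b = mat 1"
    using assms
    by (simp add: half_plane_def aff_mat_def matrix_matrix_mult_def sum_2 vec_eq_iff forall_2
        mat_def)
  have ba: "?b ** aff_mat a = mat 1"
    using ab by (simp add: matrix_left_right_inverse)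
  have "aff_mat a ** matrix_inv (aff_mat a) = mat 1 \<and> matrix_inv (aff_mat a) ** aff_mat a = mat 1"
    unfolding matrix_inv_def by (rule someI[of _ ?b], rule conjI[OF ab ba])
  then have "matrix_inv (aff_mat a) = ?b"
    by (metis ab matrix_mul_assoc matrix_mul_lid matrix_mul_rid)
  then show ?thesis
    by (simp add: group_inverse_def aff_group_chart(3))
qed

lemma e1_eq: "e1 p = (snd p, 0)"
  by (simp add: e1_def left_invariant_field_def mat_coords_def aff_mat_def
      matrix_matrix_mult_def sum_2)

lemma e2_eq: "e2 lam p = (0, snd p / lam)"
  by (simp add: e2_def left_invariant_field_def mat_coords_def aff_mat_def
      matrix_matrix_mult_def sum_2)

lemma orthonormal_frame:
  assumes "lam > 0" "p \<in> half_plane"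
  shows "metric_G lam p (e1 p) (e1 p) = 1" "metric_G lam p (e1 p) (e2 lam p) = 0"
    "metric_G lam p (e2 lam p) (e2 lam p) = 1"
  using assms by (simp_all add: metric_G_def e1_eq e2_eq half_plane_def power2_eq_square)

lemma bracket_e1_e2: "lie_bracket e1 (e2 lam) p = - (1 / lam) *\<^sub>R e1 p"
proof -
  have 1: "(e1 has_derivative (\<lambda>v. (snd v, 0))) (at p)"
    unfolding e1_eq[abs_def] by (auto intro!: derivative_eq_intros)
  have 2: "(e2 lam has_derivative (\<lambda>v. (0, snd v / lam))) (at p)"
    unfolding e2_eq[abs_def] divide_inverse by (auto intro!: derivative_eq_intros)
  show ?thesis
    unfolding lie_bracket_def frechet_derivative_at[OF 1, symmetric]
      frechet_derivative_at[OF 2, symmetric]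
    by (simp add: e1_eq e2_eq)
qed

end

theory Submission
  imports Defs
begin

text \<open>
  Left translations act on constant coordinate vector fields by scalars, so every left-invariant
  connection has the form \<open>D X Y = dY(X) + B(X, Y) / y\<close> in the chart, with a constant bilinear map
  \<open>B\<close>. The Levi-Civita connection is the case of an explicit \<open>B\<^sub>0\<close>, and a statistical structure has
  \<open>B = B\<^sub>0 - k / 2\<close>, where \<open>k\<close> is the skewness operator, given by four constants \<open>a, b, c, d\<close>; the dual
  connection belongs to \<open>B\<^sub>0 + k / 2\<close>. All tensors in the four conditions are then powers of \<open>1 / y\<close>
  times constant multilinear maps, and each condition turns out to say \<open>a = c = 0\<close> and
  \<open>d = 2 \<lambda>\<^sup>2 b\<close>. The parameter \<open>p\<close> is \<open>b / \<lambda>\<close>.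
\<close>

section \<open>Smooth functions\<close>

text \<open>The three equations have a simple origin. For the direction \<open>(0, 1)\<close> the
  map \<open>B\<^sub>0\<close> is minus the identity, which exactly balances the derivative of the
  weight in \<open>1 / y\<close>; hence the Levi-Civita derivatives of the cubic form and of the
  skewness operator vanish along it. Symmetry then asks the derivative along \<open>(1, 0)\<close>
  to vanish as soon as another argument is \<open>(0, 1)\<close>: three linear equations for
  \<open>a, b, c, d\<close>, with a line of solutions. The terms quadratic in \<open>k\<close> that
  occur in the second and fourth conditions cancel, so all conditions lead to the same linear
  system, and no implication between two of them has to be proved directly. What shapes the
  bookkeeping is that the Levi-Civita connection, the skewness operator and the dual connection are
  chosen operators, determined only at points of the half plane and at smooth fields. Every field to
  which such an operator is applied must first be known to be smooth.\<close>

lemma frechet_derivative_cong_open: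
  assumes "open U" "p \<in> U" "\<And>q. q \<in> U \<Longrightarrow> f q = g q"
  shows "frechet_derivative f (at p) = frechet_derivative g (at p)"
proof -
  \<comment> \<open>Both functions have the same derivatives, if any, so the choices made by
    \<open>frechet_derivative\<close> agree even where neither function is differentiable.\<close>
  have "(f has_derivative D) (at p) \<longleftrightarrow> (g has_derivative D) (at p)" for D
    using assms by (metis has_derivative_transform_within_open)
  then show ?thesis by (simp add: frechet_derivative_def)
qed

lemma Ck_on_cong:
  assumes "open U" and "Ck_on k U f" and "\<And>p. p \<in> U \<Longrightarrow> f p = g p"
  shows "Ck_on k U g"
  using assms(2,3)
proof (induction k arbitrary: f g)
  case 0
  then show ?case by (simp cong: continuous_on_cong)
next
  case (Suc k)
  have D: "(g has_derivative frechet_derivative f (at p)) (at p)" if "p \<in> U" for p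
    using Suc.prems that assms(1)
    by (metis Ck_on.simps(2) frechet_derivative_works has_derivative_transform_within_open)
  then have eq: "frechet_derivative f (at p) = frechet_derivative g (at p)" if "p \<in> U" for p
    using frechet_derivative_at that by blast
  have "Ck_on k U (\<lambda>p. frechet_derivative g (at p) v)" for v
  proof (rule Suc.IH)
    show "Ck_on k U (\<lambda>p. frechet_derivative f (at p) v)"
      using Suc.prems by simp
  qed (simp add: eq)
  moreover have "g differentiable (at p)" if "p \<in> U" for p
    using D[OF that] by (auto simp: differentiable_def)
  ultimately show ?case by simp
qed

text \<open>Uniqueness of derivatives identifies an explicit \<open>f'\<close> with the chosen
  \<open>frechet_derivative\<close>; the inductions below can then use the usual differentiation
  rules.\<close>

lemma Ck_on_SucI:
  assumes "open U"
    and "\<And>p. p \<in> U \<Longrightarrow> (f has_derivative f' p) (at p)"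
    and "\<And>v. Ck_on k U (\<lambda>p. f' p v)"
  shows "Ck_on (Suc k) U f"
proof -
  have "f' p = frechet_derivative f (at p)" if "p \<in> U" for p
    using assms(2)[OF that] by (rule frechet_derivative_at)
  then have "Ck_on k U (\<lambda>p. frechet_derivative f (at p) v)" for v
    by (intro Ck_on_cong[OF assms(1) assms(3)[of v]]) simp
  then show ?thesis using assms(2) by (auto simp: differentiable_def)
qed

lemma Ck_on_has_derivative:
  assumes "Ck_on (Suc k) U f" "p \<in> U"
  shows "(f has_derivative frechet_derivative f (at p)) (at p)"
  using assms by (simp add: frechet_derivative_works)

lemma Ck_on_Suc_imp_Ck_on:
  "Ck_on (Suc k) U f \<Longrightarrow> Ck_on k U f"
proof (induction k arbitrary: f)
  case 0
  then show ?case
    by (auto intro!: differentiable_imp_continuous_on differentiable_at_imp_differentiable_on)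
next
  case (Suc k)
  then show ?case unfolding Ck_on.simps(2)[of "Suc k"] Ck_on.simps(2)[of k U f]
    by blast
qed

lemma Ck_on_const: "Ck_on k U (\<lambda>_. c)"
proof (induction k arbitrary: c)
  case (Suc k)
  then show ?case by (simp add: frechet_derivative_const)
qed simp

lemma Ck_on_add:
  assumes "open U"
  shows "Ck_on k U f \<Longrightarrow> Ck_on k U g \<Longrightarrow> Ck_on k U (\<lambda>p. f p + g p)"
proof (induction k arbitrary: f g)
  case 0
  then show ?case by (simp add: continuous_on_add)
next
  case (Suc k)
  show ?case
    by (rule Ck_on_SucI[OF assms has_derivative_add[OF Ck_on_has_derivative[OF Suc.prems(1)]
            Ck_on_has_derivative[OF Suc.prems(2)]]])
      (use Suc in simp_all)
qed

lemma Ck_on_bounded_linear: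
  assumes "open U" "bounded_linear L"
  shows "Ck_on k U f \<Longrightarrow> Ck_on k U (\<lambda>p. L (f p))"
proof (induction k arbitrary: f)
  case 0
  then show ?case using assms by (simp add: bounded_linear.continuous_on)
next
  case (Suc k)
  show ?case
    by (rule Ck_on_SucI[OF assms(1) bounded_linear.has_derivative[OF assms(2)
            Ck_on_has_derivative[OF Suc.prems]]])
      (use Suc in simp_all)
qed

lemma Ck_on_bounded_bilinear:
  assumes "open U" "bounded_bilinear B"
  shows "Ck_on k U f \<Longrightarrow> Ck_on k U g \<Longrightarrow> Ck_on k U (\<lambda>p. B (f p) (g p))"
proof (induction k arbitrary: f g)
  case 0
  then show ?case using assms by (simp add: bounded_bilinear.continuous_on)
next
  case (Suc k)
  show ?case
  proof (rule Ck_on_SucI[OF assms(1)])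
    show "((\<lambda>p. B (f p) (g p)) has_derivative
        (\<lambda>h. B (f p) (frechet_derivative g (at p) h) + B (frechet_derivative f (at p) h) (g p)))
        (at p)" if "p \<in> U" for p
      using that Suc.prems assms(2)
      by (intro bounded_bilinear.FDERIV Ck_on_has_derivative)
    show "Ck_on k U (\<lambda>p. B (f p) (frechet_derivative g (at p) v) +
        B (frechet_derivative f (at p) v) (g p))" for v
      using Suc.prems Suc.prems[THEN Ck_on_Suc_imp_Ck_on]
      by (intro Ck_on_add assms(1) Suc.IH) simp_all
  qed
qed

text \<open>The derivative of \<open>1 / f\<close> is built from \<open>1 / f\<close> and the
  derivative of \<open>f\<close>, so the case \<open>k\<close> supplies the case
  \<open>Suc k\<close> for the same \<open>f\<close>.\<close>

lemma Ck_on_inverse: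
  fixes f :: "'a::euclidean_space \<Rightarrow> real"
  assumes "open U" "\<And>p. p \<in> U \<Longrightarrow> f p \<noteq> 0"
  shows "Ck_on k U f \<Longrightarrow> Ck_on k U (\<lambda>p. inverse (f p))"
proof (induction k)
  case 0
  then show ?case using assms(2) by (auto intro!: continuous_on_inverse)
next
  case (Suc k)
  have IH: "Ck_on k U (\<lambda>p. inverse (f p))"
    using Suc by (blast intro: Ck_on_Suc_imp_Ck_on)
  show ?case
  proof (rule Ck_on_SucI[OF assms(1)])
    show "((\<lambda>p. inverse (f p)) has_derivative
        (\<lambda>h. - (inverse (f p) * frechet_derivative f (at p) h * inverse (f p)))) (at p)"
      if "p \<in> U" for p
      using that assms(2) Suc.prems by (intro Deriv.has_derivative_inverse Ck_on_has_derivative)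
    show "Ck_on k U (\<lambda>p. - (inverse (f p) * frechet_derivative f (at p) v * inverse (f p)))" for v
      using Suc.prems IH
      by (intro Ck_on_bounded_linear[OF assms(1) bounded_linear_minus[OF bounded_linear_ident]]
          Ck_on_bounded_bilinear[OF assms(1) bounded_bilinear_mult]) simp_all
  qed
qed

lemma smooth_on_cong:
  assumes "open U" "smooth_on U f" "\<And>p. p \<in> U \<Longrightarrow> f p = g p"
  shows "smooth_on U g"
  using assms Ck_on_cong unfolding smooth_on_def by blast

lemma smooth_on_const: "smooth_on U (\<lambda>_. c)"
  by (simp add: smooth_on_def Ck_on_const)

lemma smooth_on_add:
  "open U \<Longrightarrow> smooth_on U f \<Longrightarrow> smooth_on U g \<Longrightarrow> smooth_on U (\<lambda>p. f p + g p)"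
  by (simp add: smooth_on_def Ck_on_add)

lemma smooth_on_bounded_linear:
  "open U \<Longrightarrow> bounded_linear L \<Longrightarrow> smooth_on U f \<Longrightarrow> smooth_on U (\<lambda>p. L (f p))"
  by (simp add: smooth_on_def Ck_on_bounded_linear)

lemma smooth_on_bounded_bilinear:
  "open U \<Longrightarrow> bounded_bilinear B \<Longrightarrow> smooth_on U f \<Longrightarrow> smooth_on U g \<Longrightarrow>
    smooth_on U (\<lambda>p. B (f p) (g p))"
  by (simp add: smooth_on_def Ck_on_bounded_bilinear)

lemma smooth_on_inverse:
  fixes f :: "'a::euclidean_space \<Rightarrow> real"
  shows "open U \<Longrightarrow> (\<And>p. p \<in> U \<Longrightarrow> f p \<noteq> 0) \<Longrightarrow> smooth_on U f \<Longrightarrow> smooth_on U (\<lambda>p. inverse (f p))"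
  by (simp add: smooth_on_def Ck_on_inverse)

lemma smooth_on_ident:
  assumes "open U"
  shows "smooth_on U (\<lambda>p. p)"
  unfolding smooth_on_def
proof
  show "Ck_on k U (\<lambda>p. p)" for k
  proof (cases k)
    case (Suc n)
    show ?thesis unfolding Suc
      by (rule Ck_on_SucI[OF assms has_derivative_ident Ck_on_const])
  qed simp
qed

lemma smooth_on_has_derivative:
  "smooth_on U f \<Longrightarrow> p \<in> U \<Longrightarrow> (f has_derivative frechet_derivative f (at p)) (at p)"
  unfolding smooth_on_def by (blast intro: Ck_on_has_derivative)

lemma smooth_on_frechet_derivative:
  "smooth_on U f \<Longrightarrow> smooth_on U (\<lambda>p. frechet_derivative f (at p) v)"
  unfolding smooth_on_def by (metis Ck_on.simps(2))

lemma smooth_on_sum: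
  assumes "open U" "finite I" "\<And>i. i \<in> I \<Longrightarrow> smooth_on U (f i)"
  shows "smooth_on U (\<lambda>p. \<Sum>i\<in>I. f i p)"
  using assms(2,3)
  by (induction I rule: finite_induct) (auto intro!: smooth_on_const smooth_on_add assms(1))

text \<open>\<open>Ck_on\<close> speaks of derivatives in fixed directions only. Expanding the
  moving direction \<open>X p\<close> in the standard basis reduces to these, with smooth
  coefficients.\<close>

lemma smooth_on_derivative_along:
  assumes "open U" "smooth_on U X" "smooth_on U Y"
  shows "smooth_on U (\<lambda>p. frechet_derivative Y (at p) (X p))"
proof (rule smooth_on_cong[OF assms(1)])
  show "smooth_on U (\<lambda>p. \<Sum>b\<in>Basis. (X p \<bullet> b) *\<^sub>R frechet_derivative Y (at p) b)"
    using assms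
    by (intro smooth_on_sum smooth_on_bounded_bilinear[OF _ bounded_bilinear_scaleR]
        smooth_on_bounded_bilinear[OF _ bounded_bilinear_inner]
        smooth_on_frechet_derivative smooth_on_const) simp_all
  fix p assume "p \<in> U"
  then interpret L: bounded_linear "frechet_derivative Y (at p)"
    using assms(3) by (blast intro: smooth_on_has_derivative has_derivative_bounded_linear)
  have "frechet_derivative Y (at p) (X p) = frechet_derivative Y (at p) (\<Sum>b\<in>Basis. (X p \<bullet> b) *\<^sub>R b)"
    by (simp add: euclidean_representation)
  also have "\<dots> = (\<Sum>b\<in>Basis. (X p \<bullet> b) *\<^sub>R frechet_derivative Y (at p) b)"
    by (simp add: L.sum L.scaleR)
  finally show "(\<Sum>b\<in>Basis. (X p \<bullet> b) *\<^sub>R frechet_derivative Y (at p) b)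
    = frechet_derivative Y (at p) (X p)" by simp
qed

section \<open>Affine connections\<close>

lemma vector_fields_iff: "X \<in> vector_fields U \<longleftrightarrow> smooth_on U X"
  by (simp add: vector_fields_def)

lemma
  assumes "affine_connection U D"
  shows affine_connection_smooth: "smooth_on U X \<Longrightarrow> smooth_on U Y \<Longrightarrow> smooth_on U (D X Y)"
    and affine_connection_add_left: "smooth_on U X \<Longrightarrow> smooth_on U X' \<Longrightarrow> smooth_on U Y \<Longrightarrow>
      p \<in> U \<Longrightarrow> D (\<lambda>q. X q + X' q) Y p = D X Y p + D X' Y p"
    and affine_connection_add_right: "smooth_on U X \<Longrightarrow> smooth_on U Y \<Longrightarrow> smooth_on U Y' \<Longrightarrow>
      p \<in> U \<Longrightarrow> D X (\<lambda>q. Y q + Y' q) p = D X Y p + D X Y' p"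
    and affine_connection_scale_left: "smooth_on U f \<Longrightarrow> smooth_on U X \<Longrightarrow> smooth_on U Y \<Longrightarrow>
      p \<in> U \<Longrightarrow> D (\<lambda>q. f q *\<^sub>R X q) Y p = f p *\<^sub>R D X Y p"
    and affine_connection_Leibniz: "smooth_on U f \<Longrightarrow> smooth_on U X \<Longrightarrow> smooth_on U Y \<Longrightarrow>
      p \<in> U \<Longrightarrow> D X (\<lambda>q. f q *\<^sub>R Y q) p = f p *\<^sub>R D X Y p + vf_apply X f p *\<^sub>R Y p"
proof -
  note * = assms[unfolded affine_connection_def Ball_def vector_fields_iff]
  show "smooth_on U X \<Longrightarrow> smooth_on U Y \<Longrightarrow> smooth_on U (D X Y)"
    using *[THEN conjunct1] by simp
  show "smooth_on U X \<Longrightarrow> smooth_on U X' \<Longrightarrow> smooth_on U Y \<Longrightarrow>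
      p \<in> U \<Longrightarrow> D (\<lambda>q. X q + X' q) Y p = D X Y p + D X' Y p"
    using *[THEN conjunct2, THEN conjunct2, THEN conjunct1] by simp
  show "smooth_on U X \<Longrightarrow> smooth_on U Y \<Longrightarrow> smooth_on U Y' \<Longrightarrow>
      p \<in> U \<Longrightarrow> D X (\<lambda>q. Y q + Y' q) p = D X Y p + D X Y' p"
    using *[THEN conjunct2, THEN conjunct2, THEN conjunct2, THEN conjunct1] by simp
  show "smooth_on U f \<Longrightarrow> smooth_on U X \<Longrightarrow> smooth_on U Y \<Longrightarrow>
      p \<in> U \<Longrightarrow> D (\<lambda>q. f q *\<^sub>R X q) Y p = f p *\<^sub>R D X Y p"
    "smooth_on U f \<Longrightarrow> smooth_on U X \<Longrightarrow> smooth_on U Y \<Longrightarrow>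
      p \<in> U \<Longrightarrow> D X (\<lambda>q. f q *\<^sub>R Y q) p = f p *\<^sub>R D X Y p + vf_apply X f p *\<^sub>R Y p"
    using *[THEN conjunct2, THEN conjunct2, THEN conjunct2, THEN conjunct2] by simp_all
qed

lemma vf_apply_const [simp]: "vf_apply X (\<lambda>_. c) p = 0"
  by (simp add: vf_apply_def)

lemma affine_connection_sum_right:
  assumes "affine_connection U D" "open U" "smooth_on U X" "p \<in> U"
    and "finite I" "\<And>i. i \<in> I \<Longrightarrow> smooth_on U (F i)"
  shows "D X (\<lambda>q. \<Sum>i\<in>I. F i q) p = (\<Sum>i\<in>I. D X (F i) p)"
  using assms(5,6)
proof (induction I rule: finite_induct)
  case empty
  \<comment> \<open>The zero field is written as a multiple of itself, so that the Leibniz rule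
    shows that it is sent to zero.\<close>
  have "D X (\<lambda>q. 0 *\<^sub>R 0) p = 0 *\<^sub>R D X (\<lambda>q. 0) p + vf_apply X (\<lambda>_. 0) p *\<^sub>R 0"
    by (intro affine_connection_Leibniz[OF assms(1)] assms smooth_on_const)
  then show ?case by simp
next
  case (insert i I)
  then show ?case
    by (simp add: affine_connection_add_right[OF assms(1)] assms smooth_on_sum)
qed

lemma affine_connection_sum_left:
  assumes "affine_connection U D" "open U" "smooth_on U Y" "p \<in> U"
    and "finite I" "\<And>i. i \<in> I \<Longrightarrow> smooth_on U (F i)"
  shows "D (\<lambda>q. \<Sum>i\<in>I. F i q) Y p = (\<Sum>i\<in>I. D (F i) Y p)"
  using assms(5,6)
proof (induction I rule: finite_induct)
  case empty
  have "D (\<lambda>q. 0 *\<^sub>R 0) Y p = 0 *\<^sub>R D (\<lambda>q. 0) Y p"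
    by (rule affine_connection_scale_left[OF assms(1) smooth_on_const smooth_on_const assms(3,4)])
  then show ?case by simp
next
  case (insert i I)
  then show ?case
    by (simp add: affine_connection_add_left[OF assms(1)] assms smooth_on_sum)
qed

text \<open>The difference between a connection and the flat derivative is linear over functions in
  both arguments, so it sees only the values at \<open>p\<close>. The standard basis gives global
  fields, so both arguments can be expanded on all of \<open>U\<close> without cut-off
  functions.\<close>

lemma affine_connection_decompose:
  fixes D :: "'a::euclidean_space vf_operator"
  assumes "affine_connection U D" "open U" "smooth_on U X" "smooth_on U Y" "p \<in> U"
  shows "D X Y p = frechet_derivative Y (at p) (X p) + D (\<lambda>_. X p) (\<lambda>_. Y p) p"
proof -
  have coord: "smooth_on U (\<lambda>q. Z q \<bullet> b)" if "smooth_on U Z" for Z :: "'a vfield" and b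
    using that by (intro smooth_on_bounded_bilinear[OF _ bounded_bilinear_inner] assms smooth_on_const)
  have term_smooth: "smooth_on U (\<lambda>q. (Z q \<bullet> b) *\<^sub>R b)" if "smooth_on U Z" for Z :: "'a vfield" and b
    using that
    by (intro smooth_on_bounded_bilinear[OF _ bounded_bilinear_scaleR] assms smooth_on_const coord)
  have left: "D Z (\<lambda>_. c) p = (\<Sum>b\<in>Basis. (Z p \<bullet> b) *\<^sub>R D (\<lambda>_. b) (\<lambda>_. c) p)"
    if "smooth_on U Z" for Z c
  proof -
    have "D Z (\<lambda>_. c) p = D (\<lambda>q. \<Sum>b\<in>Basis. (Z q \<bullet> b) *\<^sub>R b) (\<lambda>_. c) p"
      by (simp add: euclidean_representation)
    also have "\<dots> = (\<Sum>b\<in>Basis. (Z p \<bullet> b) *\<^sub>R D (\<lambda>_. b) (\<lambda>_. c) p)"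
      using that assms
      by (simp add: affine_connection_sum_left[OF assms(1)] term_smooth smooth_on_const
          affine_connection_scale_left[OF assms(1)] coord)
    finally show ?thesis .
  qed
  have right: "D X Z p = (\<Sum>b\<in>Basis. (Z p \<bullet> b) *\<^sub>R D X (\<lambda>_. b) p) +
      (\<Sum>b\<in>Basis. vf_apply X (\<lambda>q. Z q \<bullet> b) p *\<^sub>R b)" if "smooth_on U Z" for Z
  proof -
    have "D X Z p = D X (\<lambda>q. \<Sum>b\<in>Basis. (Z q \<bullet> b) *\<^sub>R b) p"
      by (simp add: euclidean_representation)
    also have "\<dots> = (\<Sum>b\<in>Basis. (Z p \<bullet> b) *\<^sub>R D X (\<lambda>_. b) p + vf_apply X (\<lambda>q. Z q \<bullet> b) p *\<^sub>R b)"
      using that assms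
      by (simp add: affine_connection_sum_right[OF assms(1)] term_smooth smooth_on_const
          affine_connection_Leibniz[OF assms(1)] coord)
    finally show ?thesis by (simp add: sum.distrib)
  qed
  have "vf_apply X (\<lambda>q. Y q \<bullet> b) p = frechet_derivative Y (at p) (X p) \<bullet> b" for b
  proof -
    have "((\<lambda>q. Y q \<bullet> b) has_derivative (\<lambda>v. frechet_derivative Y (at p) v \<bullet> b)) (at p)"
      by (intro has_derivative_inner_left smooth_on_has_derivative[OF assms(4,5)])
    then show ?thesis
      unfolding vf_apply_def by (metis frechet_derivative_at)
  qed
  then have "(\<Sum>b\<in>Basis. vf_apply X (\<lambda>q. Y q \<bullet> b) p *\<^sub>R b) = frechet_derivative Y (at p) (X p)"
    by (simp add: euclidean_representation)
  \<comment> \<open>The expansion is also applied to the constant fields with values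
    \<open>X p\<close> and \<open>Y p\<close>: their coefficients at \<open>p\<close> are the same,
    and the derivative term of the constant second argument vanishes.\<close>
  then show ?thesis
    using right[OF assms(4)] right[OF smooth_on_const, of "Y p"] left[OF assms(3)]
      left[OF smooth_on_const, of "X p"]
    by (simp add: add.commute)
qed

section \<open>Uniqueness of the Levi-Civita connection\<close>

lemma riemannian_metric_nondegenerate:
  assumes "riemannian_metric U g" "p \<in> U" "\<And>z. g p u z = g p v z"
  shows "u = v"
proof (rule ccontr)
  assume "u \<noteq> v"
  then have "g p (u - v) (u - v) > 0"
    using assms(1,2) by (simp add: riemannian_metric_def)
  moreover have "g p (u - v) (u - v) = g p u (u - v) - g p v (u - v)"
    using assms(1,2) by (simp add: riemannian_metric_def bilinear_lsub)
  ultimately show False using assms(3)[of "u - v"] by simp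
qed

definition metric_compatible :: "'a::euclidean_space set \<Rightarrow> 'a metric \<Rightarrow> 'a vf_operator \<Rightarrow> bool" where
  "metric_compatible U g D \<longleftrightarrow>
     (\<forall>X\<in>vector_fields U. \<forall>Y\<in>vector_fields U. \<forall>Z\<in>vector_fields U. \<forall>p\<in>U.
        vf_apply X (\<lambda>q. g q (Y q) (Z q)) p = g p (D X Y p) (Z p) + g p (Y p) (D X Z p))"

text \<open>The difference of two solutions is symmetric in its two arguments and skew with respect
  to the metric, and both together force it to vanish.\<close>

lemma levi_civita_unique:
  fixes D D' :: "'a::euclidean_space vf_operator"
  assumes "riemannian_metric U g"
    and D: "torsion_free U D" "metric_compatible U g D"
    and D': "torsion_free U D'" "metric_compatible U g D'"
    and XY: "smooth_on U X" "smooth_on U Y" and p: "p \<in> U"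
  shows "D X Y p = D' X Y p"
proof (rule riemannian_metric_nondegenerate[OF assms(1) p])
  fix z :: 'a
  define S where "S X Y = D X Y p - D' X Y p" for X Y
  have sym: "S X Y = S Y X" if "smooth_on U X" "smooth_on U Y" for X Y
  proof -
    have "D X Y p - D Y X p = D' X Y p - D' Y X p"
      using D(1) D'(1) that p by (simp add: torsion_free_def vector_fields_iff)
    then show ?thesis by (simp add: S_def algebra_simps)
  qed
  have bil: "bilinear (g p)" and gsym: "g p v w = g p w v" for v w
    using assms(1) p by (auto simp: riemannian_metric_def)
  have skew: "g p (S X Y) (Z p) = - g p (S X Z) (Y p)"
    if "smooth_on U X" "smooth_on U Y" "smooth_on U Z" for X Y Z :: "'a vfield"
  proof -
    have "g p (D X Y p) (Z p) + g p (Y p) (D X Z p) = g p (D' X Y p) (Z p) + g p (Y p) (D' X Z p)"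
      using D(2)[unfolded metric_compatible_def, rule_format, of X Y Z p]
        D'(2)[unfolded metric_compatible_def, rule_format, of X Y Z p] that p
      by (simp add: vector_fields_iff)
    then show ?thesis
      by (simp add: S_def bilinear_lsub[OF bil] gsym[of "Y p"])
  qed
  let ?Z = "\<lambda>_::'a. z"
  \<comment> \<open>Alternating skewness in the last two slots with symmetry in the first two, three
    times each, returns to the same expression with the opposite sign.\<close>
  have "g p (S X Y) (?Z p) = - g p (S X Y) (?Z p)"
    using skew[of X Y ?Z] skew[of ?Z X Y] skew[of Y ?Z X] sym[of X Y] sym[of X ?Z] sym[of ?Z Y]
      smooth_on_const[of U z] XY by simp
  then show "g p (D X Y p) z = g p (D' X Y p) z"
    by (simp add: S_def bilinear_lsub[OF bil])
qed

section \<open>Left-invariant connections in the global chart\<close>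

lemma open_half_plane: "open half_plane"
  unfolding half_plane_def by (intro open_Collect_less continuous_intros)

lemma half_planeD: "p \<in> half_plane \<Longrightarrow> snd p > 0"
  by (simp add: half_plane_def)

lemma unit_in_half_plane: "(0, 1) \<in> half_plane"
  by (simp add: half_plane_def)

lemma smooth_on_inverse_height: "smooth_on half_plane (\<lambda>p. 1 / snd p)"
  unfolding divide_inverse mult_1
  by (intro smooth_on_inverse smooth_on_bounded_linear[OF _ bounded_linear_snd] open_half_plane
      smooth_on_ident) (auto dest: half_planeD)

definition conn :: "(real \<times> real \<Rightarrow> real \<times> real \<Rightarrow> real \<times> real) \<Rightarrow> (real \<times> real) vf_operator" where
  "conn B X Y p = frechet_derivative Y (at p) (X p) + (1 / snd p) *\<^sub>R B (X p) (Y p)"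

lemma smooth_on_scaled_bilinear:
  fixes B :: "real \<times> real \<Rightarrow> real \<times> real \<Rightarrow> real \<times> real"
  assumes "bilinear B" "smooth_on half_plane X" "smooth_on half_plane Y"
  shows "smooth_on half_plane (\<lambda>p. (1 / snd p) *\<^sub>R B (X p) (Y p))"
  using assms(2,3) bilinear_conv_bounded_bilinear[THEN iffD1, OF assms(1)]
  by (intro smooth_on_bounded_bilinear[OF open_half_plane bounded_bilinear_scaleR]
      smooth_on_inverse_height smooth_on_bounded_bilinear[OF open_half_plane, of B])

lemma conn_affine_connection:
  assumes "bilinear B"
  shows "affine_connection half_plane (conn B)"
proof -
  have cong: "conn B X Y p = conn B X' Y' p"
    if "smooth_on half_plane Y" "\<forall>p\<in>half_plane. X p = X' p \<and> Y p = Y' p" "p \<in> half_plane"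
    for X X' Y Y' p
  proof -
    have "frechet_derivative Y (at p) = frechet_derivative Y' (at p)"
      using that by (intro frechet_derivative_cong_open[OF open_half_plane]) simp_all
    with that show ?thesis by (simp add: conn_def)
  qed
  have smooth: "smooth_on half_plane (conn B X Y)"
    if "smooth_on half_plane X" "smooth_on half_plane Y" for X Y
    unfolding conn_def[abs_def] using that assms
    by (intro smooth_on_add smooth_on_derivative_along smooth_on_scaled_bilinear open_half_plane)
  have add_left: "conn B (\<lambda>q. X q + X' q) Y p = conn B X Y p + conn B X' Y p"
    if "smooth_on half_plane Y" "p \<in> half_plane" for X X' Y p
    using linear_add[OF has_derivative_linear[OF smooth_on_has_derivative[OF that]]] assms
    by (simp add: conn_def bilinear_ladd scaleR_add_right)
  have add_right: "conn B X (\<lambda>q. Y q + Y' q) p = conn B X Y p + conn B X Y' p"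
    if "smooth_on half_plane Y" "smooth_on half_plane Y'" "p \<in> half_plane" for X Y Y' p
    using frechet_derivative_at[OF has_derivative_add[OF smooth_on_has_derivative[OF that(1,3)]
          smooth_on_has_derivative[OF that(2,3)]], symmetric] assms
    by (simp add: conn_def bilinear_radd scaleR_add_right)
  have scale_left: "conn B (\<lambda>q. f q *\<^sub>R X q) Y p = f p *\<^sub>R conn B X Y p"
    if "smooth_on half_plane Y" "p \<in> half_plane" for f X Y p
    using linear_cmul[OF has_derivative_linear[OF smooth_on_has_derivative[OF that]]] assms
    by (simp add: conn_def bilinear_lmul scaleR_add_right)
  have scale_right: "conn B X (\<lambda>q. f q *\<^sub>R Y q) p = f p *\<^sub>R conn B X Y p + vf_apply X f p *\<^sub>R Y p"
    if "smooth_on half_plane f" "smooth_on half_plane Y" "p \<in> half_plane"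
    for f :: "real \<times> real \<Rightarrow> real" and X Y p
    using frechet_derivative_at[OF has_derivative_scaleR[OF smooth_on_has_derivative[OF that(1,3)]
          smooth_on_has_derivative[OF that(2,3)]], symmetric] assms
    by (simp add: conn_def vf_apply_def bilinear_rmul scaleR_add_right)
  show ?thesis
    unfolding affine_connection_def
    by (intro conjI ballI allI impI)
      (simp_all only: vector_fields_iff smooth cong add_left add_right scale_left scale_right)
qed

lemma conn_torsion_free:
  assumes "\<And>u v. B u v = B v u"
  shows "torsion_free half_plane (conn B)"
  unfolding torsion_free_def
proof (intro ballI)
  fix X Y p
  show "conn B X Y p - conn B Y X p = lie_bracket X Y p"
    using assms[of "X p" "Y p"] by (simp add: conn_def lie_bracket_def)
qed

lemma left_pushforward_eq:
  "left_pushforward a X p = snd a *\<^sub>R X (left_translation (group_inverse a) p)"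
proof -
  have "(left_translation a has_derivative (\<lambda>v. snd a *\<^sub>R v)) (at q)" for q
    unfolding left_translation_eq[abs_def]
    by (auto intro!: derivative_eq_intros simp: prod_eq_iff)
  then have "frechet_derivative (left_translation a) (at q) v = snd a *\<^sub>R v" for q v
    by (metis frechet_derivative_at)
  then show ?thesis by (simp add: left_pushforward_def Let_def)
qed

text \<open>Left translation by \<open>a\<close> acts on constant coordinate vector fields as multiplication by
  \<open>snd a\<close>; translating the point \<open>p\<close> to the unit therefore determines the connection on them.\<close>

lemma left_invariant_connection_form:
  assumes "affine_connection half_plane D" "left_invariant_connection D"
  obtains B where "bilinear B"
    and "\<And>X Y p. smooth_on half_plane X \<Longrightarrow> smooth_on half_plane Y \<Longrightarrow> p \<in> half_plane \<Longrightarrow>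
      D X Y p = conn B X Y p"
proof
  define B where "B v w = D (\<lambda>_. v) (\<lambda>_. w) (0, 1)" for v w
  note const = smooth_on_const[of half_plane]
  have scale: "D (\<lambda>_. r *\<^sub>R v) (\<lambda>_. w) p = r *\<^sub>R D (\<lambda>_. v) (\<lambda>_. w) p"
    "D (\<lambda>_. v) (\<lambda>_. r *\<^sub>R w) p = r *\<^sub>R D (\<lambda>_. v) (\<lambda>_. w) p" if "p \<in> half_plane" for r v w p
    using affine_connection_scale_left[OF assms(1) const const const that]
      affine_connection_Leibniz[OF assms(1) const const const that] by simp_all
  show "bilinear B"
    unfolding bilinear_def linear_iff B_def
    using affine_connection_add_left[OF assms(1) const const const unit_in_half_plane]
      affine_connection_add_right[OF assms(1) const const const unit_in_half_plane]
      scale[OF unit_in_half_plane] by simp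
  have const_fields: "D (\<lambda>_. v) (\<lambda>_. w) p = (1 / snd p) *\<^sub>R B v w" if p: "p \<in> half_plane" for v w p
  proof -
    have "left_translation (group_inverse p) p = (0, 1)"
      using half_planeD[OF p] by (simp add: left_translation_eq group_inverse_eq[OF p] field_simps)
    moreover have "D (left_pushforward p (\<lambda>_. v)) (left_pushforward p (\<lambda>_. w)) p =
        left_pushforward p (D (\<lambda>_. v) (\<lambda>_. w)) p"
      using assms(2) p const unfolding left_invariant_connection_def Ball_def vector_fields_iff by blast
    \<comment> \<open>The two arguments contribute a factor \<open>snd p\<close> each and the result
      only one; this is why a single power of \<open>1 / snd p\<close> remains.\<close>
    ultimately have "snd p *\<^sub>R snd p *\<^sub>R D (\<lambda>_. v) (\<lambda>_. w) p = snd p *\<^sub>R B v w"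
      by (simp add: left_pushforward_eq[abs_def] scale[OF p] B_def del: scaleR_scaleR)
    then have "snd p *\<^sub>R D (\<lambda>_. v) (\<lambda>_. w) p = B v w"
      using half_planeD[OF p] by (auto simp del: scaleR_scaleR)
    then show ?thesis using half_planeD[OF p] by (simp flip: \<open>_ = B v w\<close>)
  qed
  show "D X Y p = conn B X Y p"
    if "smooth_on half_plane X" "smooth_on half_plane Y" "p \<in> half_plane" for X Y p
    using affine_connection_decompose[OF assms(1) open_half_plane that] const_fields[OF that(3)]
    by (simp add: conn_def)
qed

section \<open>Statistical structures on the half plane\<close>

lemma has_derivative_inverse_height_power:
  assumes "snd p > 0"
  shows "((\<lambda>q. 1 / (snd q :: real) ^ n) has_derivative (\<lambda>v. - (real n * snd v) / snd p ^ Suc n)) (at p)"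
proof -
  have "((\<lambda>q. snd q ^ n) has_derivative (\<lambda>v. real n * snd v * snd p ^ (n - 1))) (at p)"
    by (intro has_derivative_power has_derivative_snd has_derivative_ident)
  then have "((\<lambda>q. inverse (snd q ^ n)) has_derivative
      (\<lambda>v. - (inverse (snd p ^ n) * (real n * snd v * snd p ^ (n - 1)) * inverse (snd p ^ n)))) (at p)"
    using assms by (intro Deriv.has_derivative_inverse) simp_all
  \<comment> \<open>For \<open>n = 0\<close> the exponent \<open>n - 1\<close> is truncated, which
    is harmless because the factor \<open>real n\<close> vanishes.\<close>
  moreover have *: "- (inverse (snd p ^ n) * (real n * snd v * snd p ^ (n - 1)) * inverse (snd p ^ n))
      = - (real n * snd v) / snd p ^ Suc n" for v :: "'a \<times> real"
    using assms by (cases n) (simp_all add: field_simps)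
  ultimately show ?thesis unfolding * inverse_eq_divide by simp
qed

text \<open>The product rule shared by all tensors below: the weight is \<open>n = 2\<close> for the
  metric, \<open>n = 3\<close> for the cubic form and \<open>n = 1\<close> for the skewness operator
  and the Christoffel part.\<close>

lemma has_derivative_weighted:
  assumes "(F has_derivative F') (at p)" "snd p > 0"
  shows "((\<lambda>q. (1 / (snd q :: real) ^ n) *\<^sub>R F q) has_derivative
      (\<lambda>v. (1 / snd p ^ n) *\<^sub>R F' v - (real n * snd v / snd p ^ Suc n) *\<^sub>R F p)) (at p)"
  using has_derivative_scaleR[OF has_derivative_inverse_height_power[OF assms(2)] assms(1), of n]
  by simp

definition gram :: "real \<Rightarrow> real \<times> real \<Rightarrow> real \<times> real \<Rightarrow> real" where
  "gram lam v w = fst v * fst w + lam\<^sup>2 * (snd v * snd w)"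

lemma metric_G_gram: "metric_G lam p v w = (1 / snd p ^ 2) *\<^sub>R gram lam v w"
  by (simp add: metric_G_def gram_def)

lemma bilinear_gram: "bilinear (gram lam)"
  unfolding bilinear_def linear_iff by (simp add: gram_def algebra_simps)

lemma has_derivative_bilinear:
  fixes B :: "'a::euclidean_space \<Rightarrow> 'b::euclidean_space \<Rightarrow> 'c::real_normed_vector"
  assumes "bilinear B" "(f has_derivative f') (at p)" "(g has_derivative g') (at p)"
  shows "((\<lambda>q. B (f q) (g q)) has_derivative (\<lambda>v. B (f p) (g' v) + B (f' v) (g p))) (at p)"
  using assms bilinear_conv_bounded_bilinear by (intro bounded_bilinear.FDERIV) blast+

text \<open>The derivatives of \<open>Y\<close> and \<open>Z\<close> cancel against the flat part of
  the connection; what remains is tensorial. The coefficient \<open>- 2\<close> comes from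
  differentiating the weight of the metric.\<close>

lemma cubic_form_conn:
  assumes "smooth_on half_plane Y" "smooth_on half_plane Z" "p \<in> half_plane"
  shows "cubic_form (metric_G lam) (conn B) X Y Z p =
    (1 / snd p ^ 3) *\<^sub>R (- 2 * snd (X p) * gram lam (Y p) (Z p)
      - gram lam (B (X p) (Y p)) (Z p) - gram lam (Y p) (B (X p) (Z p)))"
proof -
  note d = frechet_derivative_at[OF has_derivative_weighted[OF has_derivative_bilinear[OF
        bilinear_gram smooth_on_has_derivative[OF assms(1,3)] smooth_on_has_derivative[OF assms(2,3)]]
        half_planeD[OF assms(3)]], symmetric]
  show ?thesis
    unfolding cubic_form_def metric_G_gram vf_apply_def d conn_def
    using half_planeD[OF assms(3)]
    by (simp add: bilinear_ladd[OF bilinear_gram] bilinear_radd[OF bilinear_gram]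
        bilinear_lmul[OF bilinear_gram] bilinear_rmul[OF bilinear_gram] field_simps
        power2_eq_square power3_eq_cube)
qed

text \<open>The Christoffel symbols of \<open>metric_G lam\<close> at height \<open>1\<close>.\<close>

definition hyp_christoffel :: "real \<Rightarrow> real \<times> real \<Rightarrow> real \<times> real \<Rightarrow> real \<times> real" where
  "hyp_christoffel lam u v =
     (- (fst u * snd v) - snd u * fst v, fst u * fst v / lam\<^sup>2 - snd u * snd v)"

text \<open>The constants are the components \<open>xxx\<close>, \<open>xxy\<close>, \<open>xyy\<close>, \<open>yyy\<close> of the cubic form at height
  \<open>1\<close>; dividing by \<open>lam\<^sup>2\<close> raises the last index.\<close>

definition cubic_op ::
  "real \<Rightarrow> real \<Rightarrow> real \<Rightarrow> real \<Rightarrow> real \<Rightarrow> real \<times> real \<Rightarrow> real \<times> real \<Rightarrow> real \<times> real" where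
  "cubic_op lam a b c d u v =
     (a * (fst u * fst v) + b * (fst u * snd v + snd u * fst v) + c * (snd u * snd v),
      (b * (fst u * fst v) + c * (fst u * snd v + snd u * fst v) + d * (snd u * snd v)) / lam\<^sup>2)"

lemma bilinear_hyp_christoffel: "bilinear (hyp_christoffel lam)"
  unfolding bilinear_def linear_iff
  by (simp add: hyp_christoffel_def algebra_simps add_divide_distrib diff_divide_distrib)

lemma bilinear_cubic_op: "bilinear (cubic_op lam a b c d)"
  unfolding bilinear_def linear_iff
  by (simp add: cubic_op_def algebra_simps add_divide_distrib diff_divide_distrib)

text \<open>The values \<open>0\<close>, \<open>- 1 / 2\<close> and \<open>1 / 2\<close> of \<open>t\<close> give the Levi-Civita connection, the statistical
  connection and its dual.\<close>

definition skewed_christoffel :: "real \<Rightarrow> real \<Rightarrow> real \<Rightarrow> real \<Rightarrow> real \<Rightarrow> real \<Rightarrow> real \<times> real \<Rightarrow> real \<times> real \<Rightarrow> real \<times> real"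
  where "skewed_christoffel t lam a b c d u v = hyp_christoffel lam u v + t *\<^sub>R cubic_op lam a b c d u v"

lemma bilinear_skewed_christoffel: "bilinear (skewed_christoffel t lam a b c d)"
  unfolding bilinear_def linear_iff skewed_christoffel_def
  by (simp add: bilinear_ladd[OF bilinear_hyp_christoffel] bilinear_radd[OF bilinear_hyp_christoffel]
      bilinear_lmul[OF bilinear_hyp_christoffel] bilinear_rmul[OF bilinear_hyp_christoffel]
      bilinear_ladd[OF bilinear_cubic_op] bilinear_radd[OF bilinear_cubic_op]
      bilinear_lmul[OF bilinear_cubic_op] bilinear_rmul[OF bilinear_cubic_op] algebra_simps)

lemma skewed_christoffel_zero: "skewed_christoffel 0 lam a b c d = hyp_christoffel lam"
  by (simp add: skewed_christoffel_def fun_eq_iff)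

lemma skewed_christoffel_half:
  "skewed_christoffel (1 / 2) lam a b c d u v = skewed_christoffel (- (1 / 2)) lam a b c d u v + cubic_op lam a b c d u v"
  by (simp add: skewed_christoffel_def prod_eq_iff)

text \<open>At \<open>t = 0\<close> this is metric compatibility of \<open>hyp_christoffel\<close>.
  The two remaining terms both equal \<open>- t\<close> times the same symmetric cubic form, so at
  \<open>t = - (1 / 2)\<close> the cubic form is the one encoded by \<open>cubic_op\<close>.\<close>

lemma gram_skewed_christoffel:
  assumes "lam > 0"
  shows "- 2 * snd u * gram lam v w - gram lam (skewed_christoffel t lam a b c d u v) w
      - gram lam v (skewed_christoffel t lam a b c d u w) = - 2 * t * gram lam (cubic_op lam a b c d u v) w"
  using assms by (simp add: gram_def skewed_christoffel_def hyp_christoffel_def cubic_op_def field_simps)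

text \<open>A symmetric \<open>B\<close> in the plane has six constants. Symmetry of the cubic form
  gives two relations among them and leaves four, the number of coefficients of a binary cubic
  form.\<close>

lemma statistical_conn_form:
  assumes "lam > 0" "bilinear B"
    and eq: "\<And>X Y p. smooth_on half_plane X \<Longrightarrow> smooth_on half_plane Y \<Longrightarrow> p \<in> half_plane \<Longrightarrow>
      D X Y p = conn B X Y p"
    and stat: "statistical_structure half_plane (metric_G lam) D"
  obtains a b c d where "B = skewed_christoffel (- (1 / 2)) lam a b c d"
proof -
  note const = smooth_on_const[of half_plane]
  let ?x = "(1, 0) :: real \<times> real" and ?y = "(0, 1) :: real \<times> real"
  have sym: "B u v = B v u" for u v
  proof -
    have "D (\<lambda>_. u) (\<lambda>_. v) ?y - D (\<lambda>_. v) (\<lambda>_. u) ?y = lie_bracket (\<lambda>_. u) (\<lambda>_. v) ?y"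
      using stat const unit_in_half_plane
      unfolding statistical_structure_def torsion_free_def vector_fields_def by blast
    then show ?thesis
      by (simp add: eq[OF const const unit_in_half_plane] conn_def lie_bracket_def)
  qed
  have cubic: "- 2 * snd u * gram lam v w - gram lam (B u v) w - gram lam v (B u w)
      = - 2 * snd v * gram lam u w - gram lam (B v u) w - gram lam u (B v w)" for u v w
  proof -
    have "cubic_form (metric_G lam) D (\<lambda>_. u) (\<lambda>_. v) (\<lambda>_. w) ?y =
        cubic_form (metric_G lam) D (\<lambda>_. v) (\<lambda>_. u) (\<lambda>_. w) ?y"
      using stat const unit_in_half_plane
      unfolding statistical_structure_def vector_fields_def by blast
    moreover have "cubic_form (metric_G lam) D (\<lambda>_. u) (\<lambda>_. v) (\<lambda>_. w) ?y =
        cubic_form (metric_G lam) (conn B) (\<lambda>_. u) (\<lambda>_. v) (\<lambda>_. w) ?y" for u v w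
      by (simp add: cubic_form_def eq[OF const const unit_in_half_plane])
    ultimately show ?thesis
      by (simp add: cubic_form_conn[OF const const unit_in_half_plane])
  qed
  define m where "m = fst (B ?x ?x)"
  define n where "n = fst (B ?x ?y)"
  define r where "r = fst (B ?y ?y)"
  define q where "q = snd (B ?y ?y)"
  have xx: "B ?x ?x = (m, (2 + n) / lam\<^sup>2)"
    using cubic[of ?x ?y ?x] sym[of ?y ?x] assms(1) by (simp add: gram_def m_def n_def prod_eq_iff field_simps)
  have xy: "B ?x ?y = (n, r / lam\<^sup>2)"
    using cubic[of ?x ?y ?y] sym[of ?y ?x] assms(1) by (simp add: gram_def n_def r_def prod_eq_iff field_simps)
  have yy: "B ?y ?y = (r, q)"
    by (simp add: r_def q_def)
  have expand: "B u v = (fst u * fst v) *\<^sub>R B ?x ?x + (fst u * snd v + snd u * fst v) *\<^sub>R B ?x ?y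
      + (snd u * snd v) *\<^sub>R B ?y ?y" for u v
  proof -
    have e: "u = fst u *\<^sub>R ?x + snd u *\<^sub>R ?y" "v = fst v *\<^sub>R ?x + snd v *\<^sub>R ?y"
      by (simp_all add: prod_eq_iff)
    show ?thesis
      by (subst (1) e(1), subst (1) e(2), simp only: bilinear_ladd[OF assms(2)] bilinear_radd[OF assms(2)]
          bilinear_lmul[OF assms(2)] bilinear_rmul[OF assms(2)] sym[of ?y ?x])
        (simp add: algebra_simps)
  qed
  \<comment> \<open>The four constants solve \<open>B = hyp_christoffel - cubic_op / 2\<close>
    component by component.\<close>
  have "B u v = skewed_christoffel (- (1 / 2)) lam (- 2 * m) (- 2 - 2 * n) (- 2 * r) (- 2 * lam\<^sup>2 * (1 + q)) u v"
    for u v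
    unfolding expand[of u v] xx xy yy using assms(1)
    by (simp add: skewed_christoffel_def hyp_christoffel_def cubic_op_def prod_eq_iff field_simps)
  then show thesis by (intro that ext)
qed


section \<open>The Levi-Civita connection, the skewness operator and the dual connection in explicit
  form\<close>

text \<open>Equality with \<open>conn B\<close> would be too strong, since a chosen operator is
  arbitrary off the half plane and at non-smooth fields. Smoothness of the result is included so
  that such operators can be nested.\<close>

definition represented_by ::
  "(real \<times> real) vf_operator \<Rightarrow> (real \<times> real \<Rightarrow> real \<times> real \<Rightarrow> real \<times> real) \<Rightarrow> bool" where
  "represented_by D B \<longleftrightarrow>
     (\<forall>X Y. smooth_on half_plane X \<longrightarrow> smooth_on half_plane Y \<longrightarrow>
        smooth_on half_plane (D X Y) \<and> (\<forall>p\<in>half_plane. D X Y p = conn B X Y p))"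

lemma represented_by_smooth:
  "represented_by D B \<Longrightarrow> smooth_on half_plane X \<Longrightarrow> smooth_on half_plane Y \<Longrightarrow>
    smooth_on half_plane (D X Y)"
  by (simp add: represented_by_def)

lemma represented_by_eq:
  "represented_by D B \<Longrightarrow> smooth_on half_plane X \<Longrightarrow> smooth_on half_plane Y \<Longrightarrow> p \<in> half_plane \<Longrightarrow>
    D X Y p = conn B X Y p"
  by (simp add: represented_by_def)

lemma cubic_form_represented:
  assumes "lam > 0" "represented_by D (skewed_christoffel t lam a b c d)"
    and "smooth_on half_plane X" "smooth_on half_plane Y" "smooth_on half_plane Z" "p \<in> half_plane"
  shows "cubic_form (metric_G lam) D X Y Z p =
    (1 / snd p ^ 3) *\<^sub>R (- 2 * t * gram lam (cubic_op lam a b c d (X p) (Y p)) (Z p))"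
proof -
  have "cubic_form (metric_G lam) D X Y Z p = cubic_form (metric_G lam) (conn (skewed_christoffel t lam a b c d)) X Y Z p"
    using assms by (simp add: cubic_form_def represented_by_eq)
  then show ?thesis
    by (simp only: cubic_form_conn[OF assms(4-6)] gram_skewed_christoffel[OF assms(1)])
qed

text \<open>The explicit connection shows that the defining choice can be made, and uniqueness
  forces the chosen connection to agree with it.\<close>

lemma levi_civita_represented:
  assumes "lam > 0" "riemannian_metric half_plane (metric_G lam)"
  shows "represented_by (levi_civita half_plane (metric_G lam)) (hyp_christoffel lam)"
proof -
  let ?g = "metric_G lam" and ?D0 = "conn (hyp_christoffel lam)"
  let ?P = "\<lambda>D. affine_connection half_plane D \<and> torsion_free half_plane D \<and> metric_compatible half_plane ?g D"
  have affine: "affine_connection half_plane ?D0"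
    by (rule conn_affine_connection[OF bilinear_hyp_christoffel])
  \<comment> \<open>With \<open>t = 0\<close> the cubic constants are multiplied by zero; metric
    compatibility becomes the vanishing of the cubic form.\<close>
  have rep: "represented_by ?D0 (skewed_christoffel 0 lam 0 0 0 0)"
    using affine_connection_smooth[OF affine] by (simp add: represented_by_def skewed_christoffel_zero)
  have "metric_compatible half_plane ?g ?D0"
    unfolding metric_compatible_def
  proof (intro ballI)
    fix X Y Z p
    assume "X \<in> vector_fields half_plane" "Y \<in> vector_fields half_plane"
      "Z \<in> vector_fields half_plane" "p \<in> half_plane"
    then show "vf_apply X (\<lambda>q. ?g q (Y q) (Z q)) p = ?g p (?D0 X Y p) (Z p) + ?g p (Y p) (?D0 X Z p)"
      using cubic_form_represented[OF assms(1) rep, of X Y Z p]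
      by (simp add: cubic_form_def vector_fields_iff)
  qed
  moreover have "torsion_free half_plane ?D0"
    by (rule conn_torsion_free) (simp add: hyp_christoffel_def mult.commute)
  ultimately have wit: "?P ?D0" using affine by blast
  have "?P (levi_civita half_plane ?g)"
    using someI[of ?P, OF wit] unfolding levi_civita_def metric_compatible_def .
  with \<open>?P ?D0\<close> show ?thesis
    unfolding represented_by_def
    using affine_connection_smooth[of half_plane "levi_civita half_plane ?g"]
      levi_civita_unique[OF assms(2), of "levi_civita half_plane ?g" ?D0] by simp
qed

text \<open>Constant fields are smooth, so the values at \<open>p\<close> of smooth fields exhaust
  all vectors.\<close>

lemma metric_G_eqI:
  assumes "lam > 0" "riemannian_metric half_plane (metric_G lam)" "p \<in> half_plane"
    and "\<And>Z. smooth_on half_plane Z \<Longrightarrow> metric_G lam p u (Z p) = metric_G lam p v (Z p)"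
  shows "u = v"
  using riemannian_metric_nondegenerate[OF assms(2,3)] assms(4)[OF smooth_on_const] by blast

lemma skewness_represented:
  assumes "lam > 0" "riemannian_metric half_plane (metric_G lam)"
    and "represented_by D (skewed_christoffel (- (1 / 2)) lam a b c d)"
    and XY: "smooth_on half_plane X" "smooth_on half_plane Y"
  defines "K \<equiv> skewness half_plane (metric_G lam) D"
  shows "smooth_on half_plane (K X Y)"
    and "p \<in> half_plane \<Longrightarrow> K X Y p = (1 / snd p) *\<^sub>R cubic_op lam a b c d (X p) (Y p)"
proof -
  let ?K = "\<lambda>X Y p. (1 / snd p) *\<^sub>R cubic_op lam a b c d (X p) (Y p)"
  let ?P = "\<lambda>K. \<forall>X\<in>vector_fields half_plane. \<forall>Y\<in>vector_fields half_plane.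
     K X Y \<in> vector_fields half_plane \<and>
     (\<forall>Z\<in>vector_fields half_plane. \<forall>p\<in>half_plane.
        metric_G lam p (K X Y p) (Z p) = cubic_form (metric_G lam) D X Y Z p)"
  have "metric_G lam p (?K X Y p) (Z p) = cubic_form (metric_G lam) D X Y Z p"
    if "smooth_on half_plane X" "smooth_on half_plane Y" "smooth_on half_plane Z" "p \<in> half_plane"
    for X Y Z p
    using half_planeD[OF that(4)]
    by (simp add: cubic_form_represented[OF assms(1,3) that] metric_G_gram
        bilinear_lmul[OF bilinear_gram] power2_eq_square power3_eq_cube)
  then have wit: "?P ?K"
    by (simp add: vector_fields_iff smooth_on_scaled_bilinear[OF bilinear_cubic_op])
  have K: "?P K" unfolding K_def skewness_def by (rule someI[of ?P, OF wit])
  then show "smooth_on half_plane (K X Y)" using XY by (simp add: vector_fields_iff)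
  show "K X Y p = ?K X Y p" if "p \<in> half_plane"
    using K wit XY that by (intro metric_G_eqI[OF assms(1,2) that]) (simp add: vector_fields_iff)
qed

text \<open>The cubic form measures how far \<open>D\<close> is from being metric. Adding the full
  skewness operator to \<open>D\<close> in the second slot compensates this and moves
  \<open>t\<close> from \<open>- (1 / 2)\<close> to \<open>1 / 2\<close>; nondegeneracy leaves no
  other solution.\<close>

lemma dual_connection_represented:
  assumes "lam > 0" "riemannian_metric half_plane (metric_G lam)"
    and "represented_by D (skewed_christoffel (- (1 / 2)) lam a b c d)"
  shows "represented_by (dual_connection half_plane (metric_G lam) D) (skewed_christoffel (1 / 2) lam a b c d)"
proof -
  let ?g = "metric_G lam" and ?D = "conn (skewed_christoffel (1 / 2) lam a b c d)"
  let ?P = "\<lambda>D'. \<forall>X\<in>vector_fields half_plane. \<forall>Z\<in>vector_fields half_plane.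
     D' X Z \<in> vector_fields half_plane \<and>
     (\<forall>Y\<in>vector_fields half_plane. \<forall>p\<in>half_plane.
        vf_apply X (\<lambda>q. ?g q (Y q) (Z q)) p = ?g p (D X Y p) (Z p) + ?g p (Y p) (D' X Z p))"
  have smooth: "smooth_on half_plane (?D X Y)" if "smooth_on half_plane X" "smooth_on half_plane Y" for X Y
    using that by (rule affine_connection_smooth[OF conn_affine_connection[OF bilinear_skewed_christoffel]])
  have "vf_apply X (\<lambda>q. ?g q (Y q) (Z q)) p = ?g p (D X Y p) (Z p) + ?g p (Y p) (?D X Z p)"
    if "smooth_on half_plane X" "smooth_on half_plane Y" "smooth_on half_plane Z" "p \<in> half_plane"
    for X Y Z p
  proof -
    have "?D X Z p = D X Z p + (1 / snd p) *\<^sub>R cubic_op lam a b c d (X p) (Z p)"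
      using represented_by_eq[OF assms(3) that(1,3,4)]
      by (simp add: conn_def skewed_christoffel_half scaleR_add_right)
    \<comment> \<open>Total symmetry of the cubic form moves the operator from one slot of the
      metric to the other.\<close>
    moreover have "gram lam (Y p) (cubic_op lam a b c d (X p) (Z p)) = gram lam (cubic_op lam a b c d (X p) (Y p)) (Z p)"
      using assms(1) by (simp add: gram_def cubic_op_def field_simps)
    ultimately have "?g p (Y p) (?D X Z p) = ?g p (Y p) (D X Z p) +
        (1 / snd p ^ 3) *\<^sub>R gram lam (cubic_op lam a b c d (X p) (Y p)) (Z p)"
      by (simp add: metric_G_gram bilinear_radd[OF bilinear_gram] bilinear_rmul[OF bilinear_gram]
        power2_eq_square power3_eq_cube add_divide_distrib)
    then show ?thesis
      using cubic_form_represented[OF assms(1,3) that] by (simp add: cubic_form_def)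
  qed
  then have wit: "?P ?D" using smooth by (simp add: vector_fields_iff)
  have dual: "?P (dual_connection half_plane ?g D)"
    unfolding dual_connection_def by (rule someI[of ?P, OF wit])
  have sym: "?g p u v = ?g p v u" for p u v by (simp add: metric_G_def mult.commute)
  have "dual_connection half_plane ?g D X Z p = ?D X Z p"
    if XZ: "smooth_on half_plane X" "smooth_on half_plane Z" and p: "p \<in> half_plane" for X Z p
  proof (rule metric_G_eqI[OF assms(1,2) p])
    fix Y :: "(real \<times> real) vfield"
    assume "smooth_on half_plane Y"
    then have "?g p (D X Y p) (Z p) + ?g p (Y p) (dual_connection half_plane ?g D X Z p)
        = ?g p (D X Y p) (Z p) + ?g p (Y p) (?D X Z p)"
      using dual wit XZ p by (simp add: vector_fields_iff)
    then show "?g p (dual_connection half_plane ?g D X Z p) (Y p) = ?g p (?D X Z p) (Y p)"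
      by (simp add: sym[of _ _ "Y p"])
  qed
  then show ?thesis
    using dual by (simp add: represented_by_def vector_fields_iff)
qed

section \<open>Covariant derivatives and curvature\<close>

text \<open>The covariant derivative, at height \<open>1\<close>, of the cubic form with operator
  \<open>k\<close>; the coefficient \<open>- 3\<close> is the derivative of its weight.\<close>

definition cov_cubic :: "real \<Rightarrow> (real \<times> real \<Rightarrow> real \<times> real \<Rightarrow> real \<times> real) \<Rightarrow>
    (real \<times> real \<Rightarrow> real \<times> real \<Rightarrow> real \<times> real) \<Rightarrow>
    real \<times> real \<Rightarrow> real \<times> real \<Rightarrow> real \<times> real \<Rightarrow> real \<times> real \<Rightarrow> real" where
  "cov_cubic lam B k u v w z = - 3 * snd u * gram lam (k v w) z - gram lam (k (B u v) w) z
     - gram lam (k v (B u w)) z - gram lam (k v w) (B u z)"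

definition cov_op :: "(real \<times> real \<Rightarrow> real \<times> real \<Rightarrow> real \<times> real) \<Rightarrow>
    (real \<times> real \<Rightarrow> real \<times> real \<Rightarrow> real \<times> real) \<Rightarrow>
    real \<times> real \<Rightarrow> real \<times> real \<Rightarrow> real \<times> real \<Rightarrow> real \<times> real" where
  "cov_op B k u v w = - snd u *\<^sub>R k v w + B u (k v w) - k (B u v) w - k v (B u w)"

text \<open>The curvature of the connection given by \<open>B + k\<close> minus that of
  \<open>B\<close>, at height \<open>1\<close>. The terms with \<open>snd u\<close> and
  \<open>snd v\<close> come from differentiating the weight \<open>1 / y\<close> of
  \<open>k\<close>.\<close>

definition curv_diff :: "(real \<times> real \<Rightarrow> real \<times> real \<Rightarrow> real \<times> real) \<Rightarrow>
    (real \<times> real \<Rightarrow> real \<times> real \<Rightarrow> real \<times> real) \<Rightarrow>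
    real \<times> real \<Rightarrow> real \<times> real \<Rightarrow> real \<times> real \<Rightarrow> real \<times> real" where
  "curv_diff B k u v w =
     (B u (k v w) + k u (B v w) + k u (k v w) - snd u *\<^sub>R k v w)
     - (B v (k u w) + k v (B u w) + k v (k u w) - snd v *\<^sub>R k u w)"

lemma cov_deriv_form3_represented:
  assumes k: "bilinear k" and D: "represented_by D B"
    and C: "\<And>X Y Z q. smooth_on half_plane X \<Longrightarrow> smooth_on half_plane Y \<Longrightarrow> smooth_on half_plane Z \<Longrightarrow>
      q \<in> half_plane \<Longrightarrow> C X Y Z q = (1 / snd q ^ 3) *\<^sub>R gram lam (k (X q) (Y q)) (Z q)"
    and sm: "smooth_on half_plane X" "smooth_on half_plane Y" "smooth_on half_plane Z"
      "smooth_on half_plane W" and p: "p \<in> half_plane"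
  shows "cov_deriv_form3 D C X Y Z W p =
    (1 / snd p ^ 4) *\<^sub>R cov_cubic lam B k (X p) (Y p) (Z p) (W p)"
proof -
  note d = smooth_on_has_derivative[OF _ p]
  note dC = frechet_derivative_at[OF has_derivative_weighted[OF has_derivative_bilinear[OF
        bilinear_gram has_derivative_bilinear[OF k d[OF sm(2)] d[OF sm(3)]] d[OF sm(4)]]
        half_planeD[OF p]], symmetric]
  \<comment> \<open>The formula for \<open>C\<close> is known on the half plane only; openness
    allows it to be used under the derivative.\<close>
  have "frechet_derivative (C Y Z W) (at p) =
      frechet_derivative (\<lambda>q. (1 / snd q ^ 3) *\<^sub>R gram lam (k (Y q) (Z q)) (W q)) (at p)"
    by (rule frechet_derivative_cong_open[OF open_half_plane p]) (simp add: C sm)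
  then have dC': "vf_apply X (C Y Z W) p = (1 / snd p ^ 3) *\<^sub>R
      (gram lam (k (Y p) (Z p)) (frechet_derivative W (at p) (X p)) +
       gram lam (k (Y p) (frechet_derivative Z (at p) (X p)) + k (frechet_derivative Y (at p) (X p)) (Z p)) (W p))
      - (real 3 * snd (X p) / snd p ^ Suc 3) *\<^sub>R gram lam (k (Y p) (Z p)) (W p)"
    unfolding vf_apply_def dC by simp
  note DD = represented_by_smooth[OF D sm(1)]
  have y: "1 / snd p ^ 4 = (1 / snd p ^ 3) * (1 / snd p)"
    by (simp add: power_eq_if)
  show ?thesis
    unfolding cov_deriv_form3_def dC' C[OF DD[OF sm(2)] sm(3,4) p] C[OF sm(2) DD[OF sm(3)] sm(4) p]
      C[OF sm(2,3) DD[OF sm(4)] p] represented_by_eq[OF D sm(1,2) p] represented_by_eq[OF D sm(1,3) p]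
      represented_by_eq[OF D sm(1,4) p] conn_def
      bilinear_ladd[OF k] bilinear_radd[OF k] bilinear_lmul[OF k] bilinear_rmul[OF k]
      bilinear_ladd[OF bilinear_gram] bilinear_radd[OF bilinear_gram]
      bilinear_lmul[OF bilinear_gram] bilinear_rmul[OF bilinear_gram] cov_cubic_def y
    using half_planeD[OF p] by (simp add: field_simps power_eq_if)
qed

lemma cov_deriv_op_represented:
  assumes k: "bilinear k" and B: "bilinear B" and D: "represented_by D B"
    and Ksm: "\<And>X Y. smooth_on half_plane X \<Longrightarrow> smooth_on half_plane Y \<Longrightarrow> smooth_on half_plane (K X Y)"
    and K: "\<And>X Y q. smooth_on half_plane X \<Longrightarrow> smooth_on half_plane Y \<Longrightarrow> q \<in> half_plane \<Longrightarrow>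
      K X Y q = (1 / snd q) *\<^sub>R k (X q) (Y q)"
    and sm: "smooth_on half_plane X" "smooth_on half_plane Y" "smooth_on half_plane Z"
    and p: "p \<in> half_plane"
  shows "cov_deriv_op D K X Y Z p = (1 / snd p ^ 2) *\<^sub>R cov_op B k (X p) (Y p) (Z p)"
proof -
  note d = smooth_on_has_derivative[OF _ p]
  note dK = frechet_derivative_at[OF has_derivative_weighted[OF has_derivative_bilinear[OF
        k d[OF sm(2)] d[OF sm(3)]] half_planeD[OF p], of 1], symmetric]
  have "frechet_derivative (K Y Z) (at p) =
      frechet_derivative (\<lambda>q. (1 / snd q ^ 1) *\<^sub>R k (Y q) (Z q)) (at p)"
    by (rule frechet_derivative_cong_open[OF open_half_plane p]) (simp add: K sm)
  then have dK': "frechet_derivative (K Y Z) (at p) (X p) = (1 / snd p) *\<^sub>R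
       (k (Y p) (frechet_derivative Z (at p) (X p)) + k (frechet_derivative Y (at p) (X p)) (Z p))
      - (snd (X p) / snd p ^ 2) *\<^sub>R k (Y p) (Z p)"
    unfolding dK by (simp add: power2_eq_square)
  note DD = represented_by_smooth[OF D sm(1)]
  have y: "snd (X p) / snd p ^ 2 = (1 / snd p) * ((1 / snd p) * snd (X p))"
    "1 / snd p ^ 2 = (1 / snd p) * (1 / snd p)"
    by (simp_all add: power2_eq_square)
  show ?thesis
    unfolding cov_deriv_op_def represented_by_eq[OF D sm(1) Ksm[OF sm(2,3)] p] dK'
      K[OF DD[OF sm(2)] sm(3) p] K[OF sm(2) DD[OF sm(3)] p] K[OF sm(2,3) p]
      represented_by_eq[OF D sm(1,2) p] represented_by_eq[OF D sm(1,3) p] conn_def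
      bilinear_ladd[OF k] bilinear_radd[OF k] bilinear_lmul[OF k] bilinear_rmul[OF k]
      bilinear_rmul[OF B] cov_op_def y
    by (simp add: scaleR_add_right scaleR_diff_right)
qed

lemma smooth_on_lie_bracket:
  assumes "open U" "smooth_on U X" "smooth_on U Y"
  shows "smooth_on U (lie_bracket X Y)"
proof -
  have "smooth_on U (\<lambda>p. frechet_derivative Y (at p) (X p) + - frechet_derivative X (at p) (Y p))"
    using assms by (intro smooth_on_add smooth_on_derivative_along
        smooth_on_bounded_linear[OF _ bounded_linear_minus[OF bounded_linear_ident]])
  then show ?thesis by (simp add: lie_bracket_def[abs_def])
qed

text \<open>Only the first derivatives of the difference tensor enter, so that no symmetry of second
  derivatives is needed.\<close>

lemma curvature_diff_represented:
  assumes k: "bilinear k" and B: "bilinear B" and D: "represented_by D B"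
    and D': "represented_by D' (\<lambda>u v. B u v + k u v)"
    and sm: "smooth_on half_plane X" "smooth_on half_plane Y" "smooth_on half_plane Z"
    and p: "p \<in> half_plane"
  shows "curvature D' X Y Z p - curvature D X Y Z p = (1 / snd p ^ 2) *\<^sub>R curv_diff B k (X p) (Y p) (Z p)"
proof -
  note d = smooth_on_has_derivative[OF _ p]
  have step: "D' X Z q = D X Z q + (1 / snd q) *\<^sub>R k (X q) (Z q)"
    if "smooth_on half_plane X" "smooth_on half_plane Z" "q \<in> half_plane" for X Z q
    using represented_by_eq[OF D that] represented_by_eq[OF D' that]
    by (simp add: conn_def scaleR_add_right)
  \<comment> \<open>The terms of weight \<open>1 / snd p\<close> must disappear from the curvature:
    those with derivatives of \<open>Z\<close> are together symmetric in \<open>X\<close> and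
    \<open>Y\<close>, and the one with a derivative of \<open>Y\<close> antisymmetrizes to the
    bracket term.\<close>
  have second: "D' X (D' Y Z) p - D X (D Y Z) p =
      (1 / snd p) *\<^sub>R (k (Y p) (frechet_derivative Z (at p) (X p)) + k (frechet_derivative Y (at p) (X p)) (Z p)
        + k (X p) (frechet_derivative Z (at p) (Y p)))
      + (1 / snd p ^ 2) *\<^sub>R (B (X p) (k (Y p) (Z p)) + k (X p) (B (Y p) (Z p)) + k (X p) (k (Y p) (Z p))
        - snd (X p) *\<^sub>R k (Y p) (Z p))"
    if sm: "smooth_on half_plane X" "smooth_on half_plane Y" "smooth_on half_plane Z" for X Y Z
  proof -
    have "frechet_derivative (D' Y Z) (at p) =
        frechet_derivative (\<lambda>q. D Y Z q + (1 / snd q ^ 1) *\<^sub>R k (Y q) (Z q)) (at p)"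
      by (rule frechet_derivative_cong_open[OF open_half_plane p]) (simp add: step sm)
    also have "\<dots> = (\<lambda>v. frechet_derivative (D Y Z) (at p) v +
        ((1 / snd p ^ 1) *\<^sub>R (k (Y p) (frechet_derivative Z (at p) v) + k (frechet_derivative Y (at p) v) (Z p))
          - (real 1 * snd v / snd p ^ Suc 1) *\<^sub>R k (Y p) (Z p)))"
      by (rule frechet_derivative_at[symmetric], intro has_derivative_add has_derivative_weighted
          has_derivative_bilinear k d sm represented_by_smooth[OF D] half_planeD p)
    finally have dD: "frechet_derivative (D' Y Z) (at p) (X p) = frechet_derivative (D Y Z) (at p) (X p) +
        ((1 / snd p) *\<^sub>R (k (Y p) (frechet_derivative Z (at p) (X p)) + k (frechet_derivative Y (at p) (X p)) (Z p))
          - ((1 / snd p) * ((1 / snd p) * snd (X p))) *\<^sub>R k (Y p) (Z p))"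
      by simp
    have y: "1 / snd p ^ 2 = (1 / snd p) * (1 / snd p)"
      by (simp add: power2_eq_square)
    show ?thesis
      unfolding represented_by_eq[OF D sm(1) represented_by_smooth[OF D sm(2,3)] p]
        represented_by_eq[OF D' sm(1) represented_by_smooth[OF D' sm(2,3)] p] conn_def dD step[OF sm(2,3) p]
        represented_by_eq[OF D sm(2,3) p] y
        bilinear_radd[OF k] bilinear_rmul[OF k] bilinear_radd[OF B] bilinear_rmul[OF B]
      by (simp add: scaleR_add_right scaleR_diff_right)
  qed
  have bracket: "D' (lie_bracket X Y) Z p - D (lie_bracket X Y) Z p =
      (1 / snd p) *\<^sub>R (k (frechet_derivative Y (at p) (X p)) (Z p) - k (frechet_derivative X (at p) (Y p)) (Z p))"
    using step[OF smooth_on_lie_bracket[OF open_half_plane sm(1,2)] sm(3) p]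
    by (simp add: lie_bracket_def bilinear_lsub[OF k])
  have "curvature D' X Y Z p - curvature D X Y Z p =
      (D' X (D' Y Z) p - D X (D Y Z) p) - (D' Y (D' X Z) p - D Y (D X Z) p)
      - (D' (lie_bracket X Y) Z p - D (lie_bracket X Y) Z p)"
    by (simp add: curvature_def)
  then show ?thesis
    unfolding second[OF sm] second[OF sm(2,1,3)] bracket curv_diff_def
    by (simp add: scaleR_add_right scaleR_diff_right)
qed

section \<open>The algebraic conditions\<close>

definition symmetric4 :: "('a \<Rightarrow> 'a \<Rightarrow> 'a \<Rightarrow> 'a \<Rightarrow> 'b) \<Rightarrow> bool" where
  "symmetric4 T \<longleftrightarrow>
     (\<forall>u v w z. T u v w z = T v u w z \<and> T u v w z = T u w v z \<and> T u v w z = T u v z w)"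

definition symmetric3 :: "('a \<Rightarrow> 'a \<Rightarrow> 'a \<Rightarrow> 'b) \<Rightarrow> bool" where
  "symmetric3 T \<longleftrightarrow> (\<forall>u v w. T u v w = T v u w \<and> T u v w = T u w v)"

text \<open>Constant fields realize all vectors at \<open>p\<^sub>0\<close>, so that single point
  already tests the whole of \<open>\<tau>\<close>; conversely both sides of each symmetry carry the
  same scalar \<open>r p\<close>.\<close>

lemma totally_symmetric4_pointwise:
  fixes T :: "'a::euclidean_space vfield \<Rightarrow> _ \<Rightarrow> _ \<Rightarrow> _ \<Rightarrow> 'a \<Rightarrow> 'b::real_vector"
  assumes "\<And>X Y Z W p. smooth_on U X \<Longrightarrow> smooth_on U Y \<Longrightarrow> smooth_on U Z \<Longrightarrow>
      smooth_on U W \<Longrightarrow> p \<in> U \<Longrightarrow> T X Y Z W p = r p *\<^sub>R \<tau> (X p) (Y p) (Z p) (W p)"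
    and "p\<^sub>0 \<in> U" "r p\<^sub>0 \<noteq> 0"
  shows "totally_symmetric4 U T \<longleftrightarrow> symmetric4 \<tau>"
proof
  assume T: "totally_symmetric4 U T"
  have "\<tau> u v w z = \<tau> v u w z \<and> \<tau> u v w z = \<tau> u w v z \<and> \<tau> u v w z = \<tau> u v z w" for u v w z
    using T[unfolded totally_symmetric4_def, rule_format, of "\<lambda>_. u" "\<lambda>_. v" "\<lambda>_. w" "\<lambda>_. z" p\<^sub>0] assms(2,3)
    by (auto simp: vector_fields_iff smooth_on_const assms(1))
  then show "symmetric4 \<tau>" by (simp add: symmetric4_def)
next
  assume "symmetric4 \<tau>"
  then have \<tau>: "\<tau> u v w z = \<tau> v u w z" "\<tau> u v w z = \<tau> u w v z" "\<tau> u v w z = \<tau> u v z w" for u v w z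
    unfolding symmetric4_def by blast+
  show "totally_symmetric4 U T"
    unfolding totally_symmetric4_def
  proof (intro ballI conjI)
    fix X Y Z W p
    assume *: "X \<in> vector_fields U" "Y \<in> vector_fields U" "Z \<in> vector_fields U" "W \<in> vector_fields U" "p \<in> U"
    show "T X Y Z W p = T Y X Z W p"
      using * \<tau>(1)[of "X p" "Y p"] by (simp add: vector_fields_iff assms(1))
    show "T X Y Z W p = T X Z Y W p"
      using * \<tau>(2)[of "X p" "Y p" "Z p"] by (simp add: vector_fields_iff assms(1))
    show "T X Y Z W p = T X Y W Z p"
      using * \<tau>(3)[of "X p" "Y p" "Z p" "W p"] by (simp add: vector_fields_iff assms(1))
  qed
qed

lemma totally_symmetric3_pointwise:
  fixes T :: "'a::euclidean_space vfield \<Rightarrow> _ \<Rightarrow> _ \<Rightarrow> 'a \<Rightarrow> 'b::real_vector"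
  assumes "\<And>X Y Z p. smooth_on U X \<Longrightarrow> smooth_on U Y \<Longrightarrow> smooth_on U Z \<Longrightarrow>
      p \<in> U \<Longrightarrow> T X Y Z p = r p *\<^sub>R \<tau> (X p) (Y p) (Z p)"
    and "p\<^sub>0 \<in> U" "r p\<^sub>0 \<noteq> 0"
  shows "totally_symmetric3 U T \<longleftrightarrow> symmetric3 \<tau>"
proof
  assume T: "totally_symmetric3 U T"
  have "\<tau> u v w = \<tau> v u w \<and> \<tau> u v w = \<tau> u w v" for u v w
    using T[unfolded totally_symmetric3_def, rule_format, of "\<lambda>_. u" "\<lambda>_. v" "\<lambda>_. w" p\<^sub>0] assms(2,3)
    by (auto simp: vector_fields_iff smooth_on_const assms(1))
  then show "symmetric3 \<tau>" by (simp add: symmetric3_def)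
next
  assume "symmetric3 \<tau>"
  then have \<tau>: "\<tau> u v w = \<tau> v u w" "\<tau> u v w = \<tau> u w v" for u v w
    unfolding symmetric3_def by blast+
  show "totally_symmetric3 U T"
    unfolding totally_symmetric3_def
  proof (intro ballI conjI)
    fix X Y Z p
    assume *: "X \<in> vector_fields U" "Y \<in> vector_fields U" "Z \<in> vector_fields U" "p \<in> U"
    show "T X Y Z p = T Y X Z p"
      using * \<tau>(1)[of "X p" "Y p"] by (simp add: vector_fields_iff assms(1))
    show "T X Y Z p = T X Z Y p"
      using * \<tau>(2)[of "X p" "Y p" "Z p"] by (simp add: vector_fields_iff assms(1))
  qed
qed

text \<open>Generator of the line of solutions, the case \<open>b = 1\<close>, with the division by
  \<open>lam\<^sup>2\<close> carried out where it cancels.\<close>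

definition codazzi_op :: "real \<Rightarrow> real \<times> real \<Rightarrow> real \<times> real \<Rightarrow> real \<times> real" where
  "codazzi_op lam u v =
     (fst u * snd v + snd u * fst v, fst u * fst v / lam\<^sup>2 + 2 * (snd u * snd v))"

lemma cubic_op_codazzi:
  assumes "lam > 0"
  shows "cubic_op lam 0 b 0 (2 * lam\<^sup>2 * b) = (\<lambda>u v. b *\<^sub>R codazzi_op lam u v)"
  using assms by (simp add: fun_eq_iff cubic_op_def codazzi_op_def field_simps)

text \<open>The terms with \<open>t\<close> sum the products \<open>gram (k u v) (k w z)\<close>
  over the three pairings of the four arguments. Such a sum is totally symmetric, so the condition
  is linear in the constants and the same for every \<open>t\<close>.\<close>

lemma symmetric4_cov_cubic_iff:
  assumes "lam > 0"
  shows "symmetric4 (cov_cubic lam (skewed_christoffel t lam a b c d) (cubic_op lam a b c d)) \<longleftrightarrow>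
    a = 0 \<and> c = 0 \<and> d = 2 * lam\<^sup>2 * b" (is "symmetric4 ?T \<longleftrightarrow> ?P")
proof
  assume "symmetric4 ?T"
  then have "?T (1, 0) (0, 1) w z = ?T (0, 1) (1, 0) w z" for w z
    unfolding symmetric4_def by blast
  \<comment> \<open>The three instances amount to \<open>a = 2 * c / lam\<^sup>2\<close>,
    \<open>d = 2 * lam\<^sup>2 * b\<close> and \<open>3 * c = 0\<close>, in this order.\<close>
  from this[of "(1, 0)" "(1, 0)"] this[of "(1, 0)" "(0, 1)"] this[of "(0, 1)" "(0, 1)"] assms
  show ?P
    by (simp add: cov_cubic_def skewed_christoffel_def hyp_christoffel_def cubic_op_def gram_def field_simps)
      (auto simp: power_numeral_reduce)
next
  assume ?P
  then have k: "cubic_op lam a b c d = (\<lambda>u v. b *\<^sub>R codazzi_op lam u v)"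
    by (simp add: cubic_op_codazzi[OF assms])
  show "symmetric4 ?T"
    unfolding symmetric4_def cov_cubic_def skewed_christoffel_def hyp_christoffel_def k gram_def codazzi_op_def
    using assms by (simp add: field_simps)
qed

text \<open>The Levi-Civita derivative commutes with raising an index, so the equations are those
  for the cubic form at \<open>t = 0\<close>, read off componentwise.\<close>

lemma symmetric3_cov_op_iff:
  assumes "lam > 0"
  shows "symmetric3 (cov_op (hyp_christoffel lam) (cubic_op lam a b c d)) \<longleftrightarrow>
    a = 0 \<and> c = 0 \<and> d = 2 * lam\<^sup>2 * b" (is "symmetric3 ?T \<longleftrightarrow> ?P")
proof
  assume "symmetric3 ?T"
  then have "?T (1, 0) (0, 1) w = ?T (0, 1) (1, 0) w" for w
    unfolding symmetric3_def by blast
  from this[of "(1, 0)"] this[of "(0, 1)"] assms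
  show ?P
    by (simp add: cov_op_def hyp_christoffel_def cubic_op_def prod_eq_iff field_simps)
next
  assume ?P
  then have k: "cubic_op lam a b c d = (\<lambda>u v. b *\<^sub>R codazzi_op lam u v)"
    by (simp add: cubic_op_codazzi[OF assms])
  show "symmetric3 ?T"
    unfolding symmetric3_def cov_op_def hyp_christoffel_def k codazzi_op_def
    using assms by (simp add: field_simps)
qed

text \<open>The value \<open>- (1 / 2)\<close> makes the terms quadratic in \<open>cubic_op\<close>
  cancel. What remains is \<open>cov_op\<close> for \<open>hyp_christoffel\<close>, antisymmetrized
  in \<open>u\<close> and \<open>v\<close>, so vanishing is the Codazzi equation for the skewness
  operator.\<close>

lemma curv_diff_zero_iff:
  assumes "lam > 0"
  shows "(\<forall>u v w. curv_diff (skewed_christoffel (- (1 / 2)) lam a b c d) (cubic_op lam a b c d) u v w = 0) \<longleftrightarrow>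
    a = 0 \<and> c = 0 \<and> d = 2 * lam\<^sup>2 * b" (is "(\<forall>u v w. ?T u v w = 0) \<longleftrightarrow> ?P")
proof
  assume "\<forall>u v w. ?T u v w = 0"
  \<comment> \<open>By antisymmetry in the first two arguments this one pair carries all the
    information in dimension two.\<close>
  then have "?T (1, 0) (0, 1) w = 0" for w by blast
  from this[of "(1, 0)"] this[of "(0, 1)"] assms
  show ?P
    by (simp add: curv_diff_def skewed_christoffel_def hyp_christoffel_def cubic_op_def prod_eq_iff field_simps)
      (auto simp: power_numeral_reduce)
next
  assume ?P
  then have k: "cubic_op lam a b c d = (\<lambda>u v. b *\<^sub>R codazzi_op lam u v)"
    by (simp add: cubic_op_codazzi[OF assms])
  show "\<forall>u v w. ?T u v w = 0"
    unfolding curv_diff_def skewed_christoffel_def hyp_christoffel_def k codazzi_op_def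
    using assms by (simp add: prod_eq_iff field_simps)
qed


section \<open>Equivalence of the four conditions, and the connection in the left-invariant
  frame\<close>

theorem proposition4p2p1:
  fixes lam :: real
    and nabla :: "(real \<times> real) vf_operator"
  assumes "lam > 0"
    and "left_invariant_statistical_structure (metric_G lam) nabla"
  shows
    "let g = metric_G lam;
         nabla_g = levi_civita half_plane g;
         C = cubic_form g nabla;
         K = skewness half_plane g nabla;
         nabla_dual = dual_connection half_plane g nabla;
         cond1 = totally_symmetric4 half_plane (cov_deriv_form3 nabla_g C);
         cond2 = totally_symmetric4 half_plane (cov_deriv_form3 nabla C);
         cond3 = totally_symmetric3 half_plane (cov_deriv_op nabla_g K);
         cond4 = (\<forall>X\<in>vector_fields half_plane. \<forall>Y\<in>vector_fields half_plane.
                  \<forall>Z\<in>vector_fields half_plane. \<forall>q\<in>half_plane.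
                    curvature nabla X Y Z q = curvature nabla_dual X Y Z q)
     in (cond1 \<longleftrightarrow> cond2) \<and> (cond2 \<longleftrightarrow> cond3) \<and> (cond3 \<longleftrightarrow> cond4) \<and>
        (cond1 \<or> cond2 \<or> cond3 \<or> cond4 \<longrightarrow>
          (\<exists>p::real. \<forall>q\<in>half_plane.
             nabla e1 e1 q = (1 / lam - p / 2) *\<^sub>R e2 lam q \<and>
             nabla e1 (e2 lam) q = (- 1 / lam - p / 2) *\<^sub>R e1 q \<and>
             nabla (e2 lam) e1 q = (- p / 2) *\<^sub>R e1 q \<and>
             nabla (e2 lam) (e2 lam) q = (- p) *\<^sub>R e2 lam q))"
proof -
  let ?g = "metric_G lam"
  let ?nabla_g = "levi_civita half_plane ?g"
  let ?C = "cubic_form ?g nabla"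
  let ?K = "skewness half_plane ?g nabla"
  let ?dual = "dual_connection half_plane ?g nabla"
  have stat: "statistical_structure half_plane ?g nabla"
    and inv: "left_invariant_connection nabla"
    using assms(2) by (auto simp: left_invariant_statistical_structure_def)
  then have metric: "riemannian_metric half_plane ?g" and affine: "affine_connection half_plane nabla"
    by (auto simp: statistical_structure_def)
  obtain B where B: "bilinear B" and nabla_B: "\<And>X Y p. smooth_on half_plane X \<Longrightarrow>
      smooth_on half_plane Y \<Longrightarrow> p \<in> half_plane \<Longrightarrow> nabla X Y p = conn B X Y p"
    using left_invariant_connection_form[OF affine inv] by blast
  obtain a b c d where B_eq: "B = skewed_christoffel (- (1 / 2)) lam a b c d"
    using statistical_conn_form[OF assms(1) B nabla_B stat] by blast
  let ?B = "skewed_christoffel (- (1 / 2)) lam a b c d" and ?k = "cubic_op lam a b c d"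
  let ?P = "a = 0 \<and> c = 0 \<and> d = 2 * lam\<^sup>2 * b"
  have nabla: "represented_by nabla ?B"
    using nabla_B affine_connection_smooth[OF affine] by (simp add: represented_by_def B_eq)
  have C: "?C X Y Z q = (1 / snd q ^ 3) *\<^sub>R gram lam (?k (X q) (Y q)) (Z q)"
    if "smooth_on half_plane X" "smooth_on half_plane Y" "smooth_on half_plane Z" "q \<in> half_plane"
    for X Y Z q
    using cubic_form_represented[OF assms(1) nabla that] by simp
  note nabla_g = levi_civita_represented[OF assms(1) metric]
  note K = skewness_represented[OF assms(1) metric nabla]
  have dual: "represented_by ?dual (\<lambda>u v. ?B u v + ?k u v)"
    using dual_connection_represented[OF assms(1) metric nabla]
    by (simp add: skewed_christoffel_half[abs_def])

  \<comment> \<open>Leaving \<open>t\<close> free covers two conditions at once: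
    \<open>t = 0\<close> for the Levi-Civita connection and \<open>t = - (1 / 2)\<close> for
    \<open>nabla\<close>.\<close>
  have cov_C: "totally_symmetric4 half_plane (cov_deriv_form3 D ?C) \<longleftrightarrow> ?P"
    if D: "represented_by D (skewed_christoffel t lam a b c d)" for D t
    unfolding symmetric4_cov_cubic_iff[OF assms(1), of t a b c d, symmetric]
  proof (rule totally_symmetric4_pointwise[where r = "\<lambda>p. 1 / snd p ^ 4", OF _ unit_in_half_plane])
    fix X Y Z W :: "(real \<times> real) vfield" and p
    assume "smooth_on half_plane X" "smooth_on half_plane Y" "smooth_on half_plane Z"
      "smooth_on half_plane W" "p \<in> half_plane"
    then show "cov_deriv_form3 D ?C X Y Z W p =
        (1 / snd p ^ 4) *\<^sub>R cov_cubic lam (skewed_christoffel t lam a b c d) ?k (X p) (Y p) (Z p) (W p)"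
      by (intro cov_deriv_form3_represented bilinear_cubic_op D C)
  qed simp
  have cond1: "totally_symmetric4 half_plane (cov_deriv_form3 ?nabla_g ?C) \<longleftrightarrow> ?P"
    using cov_C[of ?nabla_g 0] nabla_g by (simp add: skewed_christoffel_zero)
  have cond2: "totally_symmetric4 half_plane (cov_deriv_form3 nabla ?C) \<longleftrightarrow> ?P"
    by (rule cov_C[OF nabla])
  have cond3: "totally_symmetric3 half_plane (cov_deriv_op ?nabla_g ?K) \<longleftrightarrow> ?P"
    unfolding symmetric3_cov_op_iff[OF assms(1), of a b c d, symmetric]
  proof (rule totally_symmetric3_pointwise[where r = "\<lambda>p. 1 / snd p ^ 2", OF _ unit_in_half_plane])
    fix X Y Z :: "(real \<times> real) vfield" and p
    assume "smooth_on half_plane X" "smooth_on half_plane Y" "smooth_on half_plane Z" "p \<in> half_plane"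
    then show "cov_deriv_op ?nabla_g ?K X Y Z p =
        (1 / snd p ^ 2) *\<^sub>R cov_op (hyp_christoffel lam) ?k (X p) (Y p) (Z p)"
      by (intro cov_deriv_op_represented bilinear_cubic_op bilinear_hyp_christoffel nabla_g K)
  qed simp
  have curv: "curvature ?dual X Y Z q - curvature nabla X Y Z q =
      (1 / snd q ^ 2) *\<^sub>R curv_diff ?B ?k (X q) (Y q) (Z q)"
    if "smooth_on half_plane X" "smooth_on half_plane Y" "smooth_on half_plane Z" "q \<in> half_plane"
    for X Y Z q
    by (rule curvature_diff_represented[OF bilinear_cubic_op bilinear_skewed_christoffel nabla dual that])
  have cond4: "(\<forall>X\<in>vector_fields half_plane. \<forall>Y\<in>vector_fields half_plane.
      \<forall>Z\<in>vector_fields half_plane. \<forall>q\<in>half_plane.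
        curvature nabla X Y Z q = curvature ?dual X Y Z q) \<longleftrightarrow> ?P" (is "?R \<longleftrightarrow> _")
    unfolding curv_diff_zero_iff[OF assms(1), of a b c d, symmetric]
  proof (intro iffI allI ballI)
    fix u v w
    assume ?R
    then have "curvature nabla (\<lambda>_. u) (\<lambda>_. v) (\<lambda>_. w) (0, 1) = curvature ?dual (\<lambda>_. u) (\<lambda>_. v) (\<lambda>_. w) (0, 1)"
      using smooth_on_const[of half_plane] unit_in_half_plane unfolding vector_fields_def by blast
    then show "curv_diff ?B ?k u v w = 0"
      using curv[OF smooth_on_const smooth_on_const smooth_on_const unit_in_half_plane, of u v w] by simp
  next
    fix X Y Z :: "(real \<times> real) vfield" and q
    assume "\<forall>u v w. curv_diff ?B ?k u v w = 0"
      "X \<in> vector_fields half_plane" "Y \<in> vector_fields half_plane" "Z \<in> vector_fields half_plane"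
      "q \<in> half_plane"
    then show "curvature nabla X Y Z q = curvature ?dual X Y Z q"
      using curv[of X Y Z q] by (simp add: vector_fields_iff del: split_paired_All)
  qed

  have frame: "(e1 has_derivative (\<lambda>v. (snd v, 0))) (at q)"
    "(e2 lam has_derivative (\<lambda>v. (0, snd v / lam))) (at q)" for q
    unfolding e1_eq[abs_def] e2_eq[abs_def] divide_inverse by (auto intro!: derivative_eq_intros)
  note frame_derivative = frame[THEN frechet_derivative_at, symmetric]
  have linear_e: "bounded_linear e1" "bounded_linear (e2 lam)"
    unfolding e1_eq[abs_def] e2_eq[abs_def] divide_inverse
    by (auto intro!: bounded_linear_intros)
  have smooth_e: "smooth_on half_plane e1" "smooth_on half_plane (e2 lam)"
    using linear_e[THEN smooth_on_bounded_linear[OF open_half_plane]] smooth_on_ident[OF open_half_plane]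
    by auto
  have "\<exists>p::real. \<forall>q\<in>half_plane.
             nabla e1 e1 q = (1 / lam - p / 2) *\<^sub>R e2 lam q \<and>
             nabla e1 (e2 lam) q = (- 1 / lam - p / 2) *\<^sub>R e1 q \<and>
             nabla (e2 lam) e1 q = (- p / 2) *\<^sub>R e1 q \<and>
             nabla (e2 lam) (e2 lam) q = (- p) *\<^sub>R e2 lam q" if ?P
  \<comment> \<open>The witness is the component of the cubic form on \<open>e1, e1, e2\<close>.
    Since \<open>d = 2 * lam\<^sup>2 * b\<close>, the component on \<open>e2, e2, e2\<close> is
    \<open>d / lam ^ 3\<close>, twice the witness, which gives the coefficient \<open>- p\<close> of
    the last equation.\<close>
  proof (intro exI[of _ "b / lam"] ballI conjI)
    fix q assume q: "q \<in> half_plane"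
    note eval = represented_by_eq[OF nabla _ _ q] smooth_e conn_def frame_derivative e1_eq e2_eq
      skewed_christoffel_def hyp_christoffel_def cubic_op_def that
    show "nabla e1 e1 q = (1 / lam - b / lam / 2) *\<^sub>R e2 lam q"
      using assms(1) half_planeD[OF q] by (simp add: eval field_simps power2_eq_square)
    show "nabla e1 (e2 lam) q = (- 1 / lam - b / lam / 2) *\<^sub>R e1 q"
      using assms(1) half_planeD[OF q] by (simp add: eval field_simps power2_eq_square)
    show "nabla (e2 lam) e1 q = (- (b / lam) / 2) *\<^sub>R e1 q"
      using assms(1) half_planeD[OF q] by (simp add: eval field_simps power2_eq_square)
    show "nabla (e2 lam) (e2 lam) q = (- (b / lam)) *\<^sub>R e2 lam q"
      using assms(1) half_planeD[OF q] by (simp add: eval field_simps power2_eq_square)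
  qed
  then show ?thesis
    unfolding Let_def cond1 cond2 cond3 cond4 by simp
qed

end
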